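(* Let $v$ be an admissible weight on $\mathbb{R}^{2d}$ (in particular $v\equiv1$ is allowed). If $T\in\mathcal{A}_v$ is invertible in $B(L^2(\mathbb{R}^d))$, then $T^{-1}\in\mathcal{A}_v$. In particular (case $v\equiv 1$), if $T=\sum_{\lambda\in\Lambda}c_\lambda U_\lambda$ with $c\in\ell^1(\mathbb{R}^{2d})$, $\Lambda=\mathrm{supp}(c)$, is invertible in $B(L^2(\mathbb{R}^d))$, then there is $d\in\ell^1(\mathbb{R}^{2d})$ with support $\Sigma$ such that $T^{-1}=\sum_{\sigma\in\Sigma}d_\sigma U_\sigma$.
   Context: For $\lambda=(t,\omega)\in\mathbb{R}^d\times\mathbb{R}^d$, $U_{(t,\omega)}f(x)=e^{i\langle\omega,x\rangle}f(x-t)$ on $L^2(\mathbb{R}^d)$. A weight is a function $v:\mathbb{R}^{2d}\to[0,\infty)$ with $v(0)=1$, $v(-x)=v(x)$, radially non-decreasing. Let $w(r)=\max_{\|x\|=r}v(x)$ (Euclidean norm). $v$ is admissible if $v(x+y)\le v(x)v(y)$ for all $x,y$ and $\lim_{n\to\infty}w(nr)^{1/n}=1$ for all $r\ge0$. $\mathcal{A}_v$ is the Banach algebra of operators $T=\sum_{\lambda\in\mathbb{R}^{2d}}c_\lambda U_\lambda$ with $\|T\|_{\mathcal{A}_v}:=\sum_\lambda v(\lambda)|c_\lambda|<\infty$. $\ell^1(\mathbb{R}^{2d})$ denotes functions $c:\mathbb{R}^{2d}\to\mathbb{C}$ with $\sum_\lambda|c_\lambda|<\infty$, and $\mathrm{supp}(c)=\{\lambda: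 c_\lambda\ne0\}$. *)

theory Defs
  imports "HOL-Analysis.Analysis"
begin

text \<open>Phase space R^{2d} is modelled as (real^'d) \<times> (real^'d), pairs (t, omega);
  the norm on the product type is the Euclidean one.\<close>

definition L2 :: "(real^'d \<Rightarrow> complex) set" where
  "L2 = {f. f \<in> borel_measurable lborel \<and> integrable lborel (\<lambda>x. (cmod (f x))^2)}"

definition L2norm :: "(real^'d \<Rightarrow> complex) \<Rightarrow> real" where
  "L2norm f = sqrt (integral\<^sup>L lborel (\<lambda>x. (cmod (f x))^2))"

definition tf_shift :: "((real^'d) \<times> (real^'d)) \<Rightarrow> (real^'d \<Rightarrow> complex) \<Rightarrow> real^'d \<Rightarrow> complex" where
  "tf_shift l f x = exp (\<i> * complex_of_real (snd l \<bullet> x)) * f (x - fst l)"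

text \<open>The operator sum_lambda c_lambda U_lambda, applied pointwise (for c in l^1 and f in L^2
  the sum converges absolutely a.e. to the L^2-limit of the series).\<close>
definition series_op :: "((real^'d) \<times> (real^'d) \<Rightarrow> complex) \<Rightarrow> (real^'d \<Rightarrow> complex) \<Rightarrow> real^'d \<Rightarrow> complex" where
  "series_op c f x = (\<Sum>\<^sub>\<infinity>l. c l * tf_shift l f x)"

text \<open>Bounded linear operator on L^2 (acting on representatives, compatible with a.e. equality).\<close>
definition bounded_op_L2 :: "((real^'d \<Rightarrow> complex) \<Rightarrow> (real^'d \<Rightarrow> complex)) \<Rightarrow> bool" where
  "bounded_op_L2 S \<longleftrightarrow>
     (\<forall>f\<in>L2. S f \<in> L2) \<and>
     (\<forall>f\<in>L2. \<forall>g\<in>L2. (AE x in lborel. f x = g x) \<longrightarrow> (AE x in lborel. S f x = S g x)) \<and>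
     (\<forall>f\<in>L2. \<forall>g\<in>L2. \<forall>a b. AE x in lborel. S (\<lambda>y. a * f y + b * g y) x = a * S f x + b * S g x) \<and>
     (\<exists>C. \<forall>f\<in>L2. L2norm (S f) \<le> C * L2norm f)"

definition invertible_B_L2 :: "((real^'d \<Rightarrow> complex) \<Rightarrow> (real^'d \<Rightarrow> complex)) \<Rightarrow> bool" where
  "invertible_B_L2 T \<longleftrightarrow> bounded_op_L2 T \<and>
     (\<exists>S. bounded_op_L2 S \<and> (\<forall>f\<in>L2. AE x in lborel. S (T f) x = f x)
                          \<and> (\<forall>f\<in>L2. AE x in lborel. T (S f) x = f x))"

definition is_weight :: "((real^'d) \<times> (real^'d) \<Rightarrow> real) \<Rightarrow> bool" where
  "is_weight v \<longleftrightarrow> v 0 = 1 \<and> (\<forall>x. 0 \<le> v x) \<and> (\<forall>x. v (- x) = v x) \<and>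
     (\<forall>x s t. 0 \<le> s \<longrightarrow> s \<le> t \<longrightarrow> v (s *\<^sub>R x) \<le> v (t *\<^sub>R x))"

definition wmax :: "((real^'d) \<times> (real^'d) \<Rightarrow> real) \<Rightarrow> real \<Rightarrow> real" where
  "wmax v r = (SUP x\<in>{x. norm x = r}. v x)"

definition admissible :: "((real^'d) \<times> (real^'d) \<Rightarrow> real) \<Rightarrow> bool" where
  "admissible v \<longleftrightarrow> is_weight v \<and> (\<forall>x y. v (x + y) \<le> v x * v y) \<and>
     (\<forall>r\<ge>0. (\<lambda>n. wmax v (real n * r) powr (1 / real n)) \<longlonglongrightarrow> 1)"

definition in_Av :: "((real^'d) \<times> (real^'d) \<Rightarrow> real) \<Rightarrow> ((real^'d) \<times> (real^'d) \<Rightarrow> complex) \<Rightarrow> bool" where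
  "in_Av v c \<longleftrightarrow> (\<lambda>l. v l * cmod (c l)) summable_on UNIV"

end

theory Submission
  imports Defs
begin

text \<open>
  Writing \<open>T\<close> for the given operator and \<open>M\<close> for a bound of \<open>\<parallel>T\<parallel>\<^sup>2\<close>,
  the operator \<open>E = 1 - T\<^sup>*T/M\<close> has norm less than 1 on \<open>L\<^sup>2\<close> because
  \<open>T\<close> is bounded below, and its coefficients \<open>e\<close> are again \<open>v\<close>-summable. It suffices that
  the Neumann series of \<open>e\<close> converges in the weighted norm; then
  \<open>(\<Sum>n. E\<^sup>n) T\<^sup>*/M\<close> is the inverse.

  Split \<open>e = p + s\<close> with \<open>p\<close> supported on a finite set \<open>F\<close> and \<open>s\<close> of small weighted norm. In
  the expansion of \<open>E\<^sup>n\<close> every word is a superposition of operators \<open>Y\<close> whose coefficients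
  live on a translate of the set of sums of at most \<open>n\<close> elements of \<open>F\<close>, and the norm of \<open>Y\<close>
  is at most \<open>\<parallel>P\<parallel>\<^sup>k\<close>, where \<open>k\<close> is the number of letters \<open>p\<close>. That set has
  polynomially many elements, each coefficient of \<open>Y\<close> is bounded by its operator norm, and \<open>v\<close>
  grows subexponentially on it. So the weighted norm of \<open>e\<^sup>n\<close> is at most a subexponential factor
  times \<open>(\<parallel>P\<parallel> + \<parallel>s\<parallel>)\<^sup>n\<close>.
\<close>

subsection \<open>Sums and integrals over countable families\<close>

lemma summable_on_cmod:
  fixes a :: "'i \<Rightarrow> complex"
  assumes "a summable_on A"
  shows "(\<lambda>i. cmod (a i)) summable_on A"
  using assms by (rule iffD1[OF summable_on_iff_abs_summable_on_complex])

lemma integrable_count_space_iff_summable_on: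
  fixes f :: "'i \<Rightarrow> complex"
  shows "integrable (count_space A) f \<longleftrightarrow> f summable_on A"
  using abs_summable_equivalent[of f A] summable_on_iff_abs_summable_on_complex[of f A]
  by (simp add: Infinite_Set_Sum.abs_summable_on_def)

lemma integral_count_space_eq_infsum:
  fixes f :: "'i \<Rightarrow> complex"
  shows "integral\<^sup>L (count_space A) f = infsum f A"
proof (cases "f summable_on A")
  case True
  then show ?thesis
    using infsetsum_infsum[of f A] integrable_count_space_iff_summable_on[of A f]
    by (simp add: Infinite_Set_Sum.abs_summable_on_def infsetsum_def)
next
  case False
  then show ?thesis
    by (simp add: infsum_not_exists not_integrable_integral_eq integrable_count_space_iff_summable_on)
qed

lemma infsum_UNIV_eq_infsum_support:
  assumes "\<And>i. i \<notin> I \<Longrightarrow> h i = 0"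
  shows "infsum h UNIV = infsum h I" "h summable_on UNIV \<longleftrightarrow> h summable_on I"
proof -
  show "infsum h UNIV = infsum h I"
    by (rule infsum_cong_neutral) (auto simp: assms)
  show "h summable_on UNIV \<longleftrightarrow> h summable_on I"
    by (rule summable_on_cong_neutral) (auto simp: assms)
qed

text \<open>The unordered sum is a Bochner integral against counting measure on the countable
  support, so this is measurability of a parameter integral. At points where the family is not
  summable, both sides have the default value 0.\<close>

lemma borel_measurable_infsum_complex:
  fixes h :: "'i \<Rightarrow> 'a \<Rightarrow> complex"
  assumes supp: "countable {i. h i \<noteq> (\<lambda>_. 0)}"
    and h: "\<And>i. h i \<in> borel_measurable M"
  shows "(\<lambda>x. \<Sum>\<^sub>\<infinity>i. h i x) \<in> borel_measurable M"
proof -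
  define I where "I = {i. h i \<noteq> (\<lambda>_. 0)}"
  have I: "countable I" "\<And>i x. i \<notin> I \<Longrightarrow> h i x = 0"
    using supp by (auto simp: I_def)
  interpret C: sigma_finite_measure "count_space I"
    using I(1) by (rule sigma_finite_measure_count_space_countable)
  have "(\<lambda>(i, x). h i x) \<in> borel_measurable (count_space I \<Otimes>\<^sub>M M)"
    by (rule measurable_pair_measure_countable1[OF I(1)]) (simp add: h)
  then have "(\<lambda>(x, i). h i x) \<in> borel_measurable (M \<Otimes>\<^sub>M count_space I)"
    by (subst measurable_pair_swap_iff) (simp add: case_prod_beta)
  then have "(\<lambda>x. \<integral>i. h i x \<partial>count_space I) \<in> borel_measurable M"
    by (rule C.borel_measurable_lebesgue_integral)
  moreover have "(\<Sum>\<^sub>\<infinity>i. h i x) = (\<integral>i. h i x \<partial>count_space I)" for x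
    unfolding integral_count_space_eq_infsum
    by (rule infsum_UNIV_eq_infsum_support(1)) (simp add: I(2))
  ultimately show ?thesis by simp
qed

text \<open>Fubini on the product of \<open>M\<close> with counting measure. Passing to the
  countable support \<open>I\<close> makes that counting measure sigma-finite; outside
  \<open>I\<close> the terms vanish identically.\<close>

lemma infsum_integral_interchange:
  fixes h :: "'i \<Rightarrow> 'a \<Rightarrow> complex"
  assumes M: "sigma_finite_measure M"
    and supp: "countable {i. h i \<noteq> (\<lambda>_. 0)}"
    and h: "\<And>i. integrable M (h i)"
    and sum: "(\<lambda>i. \<integral>x. cmod (h i x) \<partial>M) summable_on UNIV"
  shows "AE x in M. (\<lambda>i. h i x) summable_on UNIV"
    and "integrable M (\<lambda>x. \<Sum>\<^sub>\<infinity>i. h i x)"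
    and "(\<integral>x. (\<Sum>\<^sub>\<infinity>i. h i x) \<partial>M) = (\<Sum>\<^sub>\<infinity>i. \<integral>x. h i x \<partial>M)"
proof -
  define I where "I = {i. h i \<noteq> (\<lambda>_. 0)}"
  have I: "countable I" "\<And>i x. i \<notin> I \<Longrightarrow> h i x = 0"
    using supp by (auto simp: I_def)
  interpret C: sigma_finite_measure "count_space I"
    using I(1) by (rule sigma_finite_measure_count_space_countable)
  interpret M: sigma_finite_measure M by fact
  interpret P: pair_sigma_finite "count_space I" M ..
  have eq: "infsum (\<lambda>i. h i x) UNIV = infsum (\<lambda>i. h i x) I" for x
    by (rule infsum_UNIV_eq_infsum_support(1)) (rule I(2))
  have eq': "(\<lambda>i. h i x) summable_on UNIV \<longleftrightarrow> (\<lambda>i. h i x) summable_on I" for x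
    by (rule infsum_UNIV_eq_infsum_support(2)) (rule I(2))
  have meas: "(\<lambda>(i, x). h i x) \<in> borel_measurable (count_space I \<Otimes>\<^sub>M M)"
    by (rule measurable_pair_measure_countable1[OF I(1)]) (use h[THEN borel_measurable_integrable] in simp)
  have "(\<lambda>i. \<integral>x. cmod (h i x) \<partial>M) summable_on I"
    using sum by (rule summable_on_subset) simp
  then have "Infinite_Sum.abs_summable_on (\<lambda>i. \<integral>x. cmod (h i x) \<partial>M) I"
    by (rule iffD1[OF summable_on_iff_abs_summable_on_real])
  then have "integrable (count_space I) (\<lambda>i. \<integral>x. cmod (h i x) \<partial>M)"
    by (simp only: abs_summable_equivalent Infinite_Set_Sum.abs_summable_on_def)
  then have int: "integrable (count_space I \<Otimes>\<^sub>M M) (\<lambda>(i, x). h i x)"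
    by (intro P.Fubini_integrable meas) (simp_all add: h AE_count_space)
  show "AE x in M. (\<lambda>i. h i x) summable_on UNIV"
    using P.AE_integrable_snd[OF int] unfolding integrable_count_space_iff_summable_on eq' .
  show "integrable M (\<lambda>x. \<Sum>\<^sub>\<infinity>i. h i x)"
    using P.integrable_snd[OF int] unfolding integral_count_space_eq_infsum eq .
  have "(\<integral>x. (\<Sum>\<^sub>\<infinity>i. h i x) \<partial>M) = (\<Sum>\<^sub>\<infinity>i\<in>I. \<integral>x. h i x \<partial>M)"
    using P.Fubini_integral[OF int] unfolding integral_count_space_eq_infsum eq .
  also have "\<dots> = (\<Sum>\<^sub>\<infinity>i. \<integral>x. h i x \<partial>M)"
    by (rule infsum_UNIV_eq_infsum_support(1)[symmetric]) (simp add: I(2))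
  finally show "(\<integral>x. (\<Sum>\<^sub>\<infinity>i. h i x) \<partial>M) = (\<Sum>\<^sub>\<infinity>i. \<integral>x. h i x \<partial>M)" .
qed

text \<open>Cauchy-Schwarz for the measure with masses \<open>u i\<close>: the sum of
  \<open>u i * (y i - t)\<^sup>2\<close> is a nonnegative quadratic polynomial in
  \<open>t\<close>.\<close>

lemma infsum_abs_Cauchy_Schwarz:
  fixes u y :: "'i \<Rightarrow> real"
  assumes u: "u summable_on UNIV" "\<And>i. 0 \<le> u i"
    and uy2: "(\<lambda>i. u i * (y i)\<^sup>2) summable_on UNIV"
  shows "(\<lambda>i. u i * y i) summable_on UNIV"
    and "(\<Sum>\<^sub>\<infinity>i. u i * y i)\<^sup>2 \<le> (\<Sum>\<^sub>\<infinity>i. u i) * (\<Sum>\<^sub>\<infinity>i. u i * (y i)\<^sup>2)"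
proof -
  have "\<bar>u i * y i\<bar> \<le> u i + u i * (y i)\<^sup>2" for i
  proof -
    have "\<bar>y i\<bar> \<le> 1 + (y i)\<^sup>2"
      using sum_squares_bound[of 1 "\<bar>y i\<bar>"] zero_le_power2[of "y i"] by simp
    then have "u i * \<bar>y i\<bar> \<le> u i * (1 + (y i)\<^sup>2)"
      using u(2) by (rule mult_left_mono)
    then show ?thesis using u(2)[of i] by (simp add: abs_mult distrib_left)
  qed
  then have "Infinite_Sum.abs_summable_on (\<lambda>i. u i * y i) UNIV"
    by (intro summable_on_comparison_test[OF summable_on_add[OF u(1) uy2]]) auto
  then show s: "(\<lambda>i. u i * y i) summable_on UNIV"
    by (rule iffD2[OF summable_on_iff_abs_summable_on_real])
  define S Z Q where "S = (\<Sum>\<^sub>\<infinity>i. u i)" and "Z = (\<Sum>\<^sub>\<infinity>i. u i * y i)" and "Q = (\<Sum>\<^sub>\<infinity>i. u i * (y i)\<^sup>2)"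
  have q: "0 \<le> Q - 2 * t * Z + t\<^sup>2 * S" for t
  proof -
    have "((\<lambda>i. u i * (y i)\<^sup>2 + ((- 2 * t) * (u i * y i) + t\<^sup>2 * u i)) has_sum (Q + ((- 2 * t) * Z + t\<^sup>2 * S))) UNIV"
      unfolding S_def Z_def Q_def using u(1) uy2 s
      by (intro has_sum_add has_sum_cmult_right has_sum_infsum)
    moreover have "u i * (y i)\<^sup>2 + ((- 2 * t) * (u i * y i) + t\<^sup>2 * u i) = u i * (y i - t)\<^sup>2" for i
      by (simp add: power2_eq_square algebra_simps)
    ultimately have "((\<lambda>i. u i * (y i - t)\<^sup>2) has_sum (Q + ((- 2 * t) * Z + t\<^sup>2 * S))) UNIV" by simp
    then have "0 \<le> Q + ((- 2 * t) * Z + t\<^sup>2 * S)"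
      by (rule has_sum_nonneg) (simp add: u(2))
    then show ?thesis by simp
  qed
  have S0: "0 \<le> S" unfolding S_def by (simp add: infsum_nonneg u(2))
  have "Z\<^sup>2 \<le> S * Q"
  proof (cases "S = 0")
    case True
    have "Z = 0"
    proof (rule ccontr)
      assume "Z \<noteq> 0"
      \<comment> \<open>For \<open>S = 0\<close> the polynomial is the affine function
        \<open>Q - 2 * t * Z\<close>, which takes the value -1 at this \<open>t\<close>.\<close>
      then show False using q[of "(Q + 1) / (2 * Z)"] True by (simp add: field_simps)
    qed
    then show ?thesis using True by simp
  next
    case False
    \<comment> \<open>\<open>Z / S\<close> is the minimum point of the quadratic.\<close>
    then show ?thesis using q[of "Z / S"] S0 
      by (simp add: field_simps power2_eq_square)
  qed
  then show "(\<Sum>\<^sub>\<infinity>i. u i * y i)\<^sup>2 \<le> (\<Sum>\<^sub>\<infinity>i. u i) * (\<Sum>\<^sub>\<infinity>i. u i * (y i)\<^sup>2)"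
    by (simp add: S_def Z_def Q_def)
qed

lemma lborel_translate:
  fixes f :: "real^'d \<Rightarrow> 'b :: {banach, second_countable_topology}"
  assumes "f \<in> borel_measurable borel"
  shows "integrable lborel (\<lambda>x. f (x - t)) \<longleftrightarrow> integrable lborel f"
    and "(\<integral>x. f (x - t) \<partial>lborel) = (\<integral>x. f x \<partial>lborel)"
proof -
  have "integrable lborel f \<longleftrightarrow> integrable (distr lborel borel ((+) (- t))) f"
    by (simp only: lborel_distr_plus)
  also have "\<dots> \<longleftrightarrow> integrable lborel (\<lambda>x. f (x - t))"
    using assms by (subst integrable_distr_eq) (auto simp: add.commute[of "- t"])
  finally show "integrable lborel (\<lambda>x. f (x - t)) \<longleftrightarrow> integrable lborel f" ..
  have "(\<integral>x. f x \<partial>lborel) = (\<integral>x. f x \<partial>distr lborel borel ((+) (- t)))"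
    by (simp only: lborel_distr_plus)
  also have "\<dots> = (\<integral>x. f (x - t) \<partial>lborel)"
    using assms by (subst integral_distr) (auto simp: add.commute[of "- t"])
  finally show "(\<integral>x. f (x - t) \<partial>lborel) = (\<integral>x. f x \<partial>lborel)" ..
qed

subsection \<open>Square-integrable functions and series of time-frequency shifts\<close>

lemma L2D:
  assumes "f \<in> L2"
  shows "f \<in> borel_measurable borel" "integrable lborel (\<lambda>x. (cmod (f x))\<^sup>2)"
  using assms by (auto simp: L2_def)

lemma L2norm_nonneg [simp]: "0 \<le> L2norm f"
  by (simp add: L2norm_def)

lemma L2norm_square: "(L2norm f)\<^sup>2 = (\<integral>x. (cmod (f x))\<^sup>2 \<partial>lborel)"
  by (simp add: L2norm_def)

lemma L2_AE_cong:
  assumes "f \<in> L2" "g \<in> borel_measurable borel" "AE x in lborel. f x = g x"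
  shows "g \<in> L2" "L2norm g = L2norm f"
proof -
  have ae: "AE x in lborel. (cmod (f x))\<^sup>2 = (cmod (g x))\<^sup>2"
    using assms(3) by eventually_elim simp
  have [measurable]: "f \<in> borel_measurable borel" "g \<in> borel_measurable borel"
    using assms L2D by auto
  have "integrable lborel (\<lambda>x. (cmod (g x))\<^sup>2)"
    using L2D(2)[OF assms(1)] ae by (subst (asm) integrable_cong_AE[where g = "\<lambda>x. (cmod (g x))\<^sup>2"]) auto
  then show "g \<in> L2" by (simp add: L2_def)
  show "L2norm g = L2norm f"
    unfolding L2norm_def using ae by (subst integral_cong_AE[where g = "\<lambda>x. (cmod (g x))\<^sup>2"]) auto
qed

lemma L2_scale:
  assumes "f \<in> L2"
  shows "(\<lambda>x. a * f x) \<in> L2" "L2norm (\<lambda>x. a * f x) = cmod a * L2norm f"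
  using L2D[OF assms] by (auto simp: L2_def L2norm_def norm_mult power_mult_distrib real_sqrt_mult)

lemma L2_add:
  assumes f: "f \<in> L2" and g: "g \<in> L2"
  shows "(\<lambda>x. f x + g x) \<in> L2" "L2norm (\<lambda>x. f x + g x) \<le> L2norm f + L2norm g"
proof -
  note [measurable] = L2D(1)[OF f] L2D(1)[OF g]
  note int = L2D(2)[OF f] L2D(2)[OF g]
  \<comment> \<open>optimising over \<open>t\<close> makes this equivalent to Minkowski's inequality\<close>
  have pt: "(cmod (f x + g x))\<^sup>2 \<le> (1 + t) * (cmod (f x))\<^sup>2 + (1 + 1 / t) * (cmod (g x))\<^sup>2"
    if "0 < t" for t x
  proof -
    define a b where "a = cmod (f x)" and "b = cmod (g x)"
    have "0 \<le> (sqrt t * a - b / sqrt t)\<^sup>2" by simp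
    then have "2 * a * b \<le> t * a\<^sup>2 + b\<^sup>2 / t"
      using that by (simp add: power2_diff power_mult_distrib power_divide)
    moreover have "(cmod (f x + g x))\<^sup>2 \<le> (a + b)\<^sup>2"
      unfolding a_def b_def by (intro power_mono norm_triangle_ineq norm_ge_zero)
    ultimately show ?thesis
      unfolding a_def[symmetric] b_def[symmetric] by (simp add: power2_sum algebra_simps)
  qed
  have int2: "integrable lborel (\<lambda>x. (1 + t) * (cmod (f x))\<^sup>2 + (1 + 1 / t) * (cmod (g x))\<^sup>2)" for t
    using int by auto
  have "integrable lborel (\<lambda>x. (cmod (f x + g x))\<^sup>2)"
    by (rule Bochner_Integration.integrable_bound[OF int2[of 1]]) (use pt[of 1] in \<open>auto intro!: AE_I2\<close>)
  then show *: "(\<lambda>x. f x + g x) \<in> L2" by (simp add: L2_def)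
  have bd: "(L2norm (\<lambda>x. f x + g x))\<^sup>2 \<le> (1 + t) * (L2norm f)\<^sup>2 + (1 + 1 / t) * (L2norm g)\<^sup>2" if "0 < t" for t
  proof -
    have "(L2norm (\<lambda>x. f x + g x))\<^sup>2 \<le> (\<integral>x. (1 + t) * (cmod (f x))\<^sup>2 + (1 + 1 / t) * (cmod (g x))\<^sup>2 \<partial>lborel)"
      unfolding L2norm_square using pt[OF that] by (intro integral_mono L2D(2)[OF *] int2) auto
    then show ?thesis using int by (simp add: L2norm_square)
  qed
  show "L2norm (\<lambda>x. f x + g x) \<le> L2norm f + L2norm g"
  proof (rule field_le_epsilon)
    fix e :: real assume e: "0 < e"
    \<comment> \<open>The halves of \<open>e\<close> keep \<open>A\<close> and \<open>B\<close>
      positive, so that the optimal choice \<open>B / A\<close> for \<open>t\<close> makes sense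
      even if a norm vanishes.\<close>
    define A where "A = L2norm f + e / 2"
    define B where "B = L2norm g + e / 2"
    have AB: "0 < A" "0 < B" "L2norm f \<le> A" "L2norm g \<le> B"
      using e by (auto simp: A_def B_def add_nonneg_pos)
    have "(L2norm (\<lambda>x. f x + g x))\<^sup>2 \<le> (1 + B / A) * (L2norm f)\<^sup>2 + (1 + 1 / (B / A)) * (L2norm g)\<^sup>2"
      using AB by (intro bd) auto
    also have "\<dots> \<le> (1 + B / A) * A\<^sup>2 + (1 + 1 / (B / A)) * B\<^sup>2"
      using AB by (intro add_mono mult_left_mono power_mono) auto
    also have "\<dots> = (A + B)\<^sup>2"
      using AB by (simp add: field_simps power2_eq_square)
    finally have "L2norm (\<lambda>x. f x + g x) \<le> A + B"
      using AB by (rule_tac power2_le_imp_le) auto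
    then show "L2norm (\<lambda>x. f x + g x) \<le> L2norm f + L2norm g + e"
      by (simp add: A_def B_def)
  qed
qed

lemma L2_diff:
  assumes "f \<in> L2" and "g \<in> L2"
  shows "(\<lambda>x. f x - g x) \<in> L2" "L2norm (\<lambda>x. f x - g x) \<le> L2norm f + L2norm g"
  using L2_add[OF assms(1) L2_scale(1)[OF assms(2), of "- 1"]] L2_scale(2)[OF assms(2), of "- 1"]
  by simp_all

lemma cmod_exp_i [simp]: "cmod (exp (\<i> * complex_of_real r)) = 1"
  by simp

lemma cmod_tf_shift: "cmod (tf_shift l f x) = cmod (f (x - fst l))"
  by (simp add: tf_shift_def norm_mult)

lemma measurable_tf_shift:
  assumes "f \<in> borel_measurable borel"
  shows "tf_shift l f \<in> borel_measurable borel"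
  unfolding tf_shift_def using assms by measurable

lemma tf_shift_L2:
  assumes "f \<in> L2"
  shows "tf_shift l f \<in> L2" "L2norm (tf_shift l f) = L2norm f"
proof -
  note [measurable] = L2D(1)[OF assms]
  have m: "(\<lambda>x. (cmod (f x))\<^sup>2) \<in> borel_measurable borel" by measurable
  show "tf_shift l f \<in> L2" "L2norm (tf_shift l f) = L2norm f"
    using lborel_translate[OF m, of "fst l"] L2D[OF assms] measurable_tf_shift[OF L2D(1)[OF assms], of l]
    by (simp_all add: L2_def L2norm_def cmod_tf_shift)
qed

text \<open>Makes Fubini applicable although the index set of the series is uncountable.\<close>

lemma countable_support:
  fixes a :: "'i \<Rightarrow> complex"
  assumes "a summable_on UNIV"
  shows "countable {i. a i \<noteq> 0}"
  using summable_countable_complex[OF assms] by simp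

text \<open>Lebesgue measure is translation invariant, so every translate contributes the same
  integral and Fubini applies. The index type and the shifts \<open>t i\<close> are left general
  because products of series are indexed by pairs of phase space points, and series of series by a
  number and a point.\<close>

lemma AE_summable_translates:
  fixes a :: "'i \<Rightarrow> complex" and f :: "real^'d \<Rightarrow> complex"
  assumes a: "a summable_on UNIV" and f: "f \<in> L2"
  shows "AE x in lborel. (\<lambda>i. cmod (a i) * (cmod (f (x - t i)))\<^sup>2) summable_on UNIV"
    and "integrable lborel (\<lambda>x. \<Sum>\<^sub>\<infinity>i. cmod (a i) * (cmod (f (x - t i)))\<^sup>2)"
    and "(\<integral>x. (\<Sum>\<^sub>\<infinity>i. cmod (a i) * (cmod (f (x - t i)))\<^sup>2) \<partial>lborel)
           = (\<Sum>\<^sub>\<infinity>i. cmod (a i)) * (L2norm f)\<^sup>2"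
proof -
  note [measurable] = L2D(1)[OF f]
  define h where "h i x = complex_of_real (cmod (a i) * (cmod (f (x - t i)))\<^sup>2)" for i x
  have m: "(\<lambda>x. (cmod (f x))\<^sup>2) \<in> borel_measurable borel" by measurable
  have int: "integrable lborel (\<lambda>x. (cmod (f (x - t i)))\<^sup>2)"
      "(\<integral>x. (cmod (f (x - t i)))\<^sup>2 \<partial>lborel) = (L2norm f)\<^sup>2" for i
    using lborel_translate[OF m, of "t i"] L2D(2)[OF f] by (simp_all add: L2norm_square)
  have na: "(\<lambda>i. cmod (a i)) summable_on UNIV"
    by (rule summable_on_cmod[OF a])
  have inth: "(\<integral>x. cmod (h i x) \<partial>lborel) = cmod (a i) * (L2norm f)\<^sup>2" for i
    by (simp only: h_def norm_of_real) (simp add: abs_mult int)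
  have inth': "(\<integral>x. h i x \<partial>lborel) = complex_of_real (cmod (a i) * (L2norm f)\<^sup>2)" for i
    by (simp add: h_def int flip: of_real_mult of_real_power)
  have sf: "sigma_finite_measure (lborel :: (real^'d) measure)" by (rule sigma_finite_lborel)
  have supp: "countable {i. h i \<noteq> (\<lambda>_. 0)}"
    by (rule countable_subset[OF _ countable_support[OF a]]) (auto simp: h_def)
  have hi: "integrable lborel (h i)" for i
    unfolding h_def using int(1)[of i] by (intro integrable_of_real integrable_mult_right)
  have hs: "(\<lambda>i. \<integral>x. cmod (h i x) \<partial>lborel) summable_on UNIV"
    unfolding inth by (rule summable_on_cmult_left[OF na])
  note F = infsum_integral_interchange[where h = h, OF sf supp hi hs]
  \<comment> \<open>The interchange lemma is complex-valued, hence the detour through real parts.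
    Where summability fails, both sides are 0.\<close>
  have re: "(\<Sum>\<^sub>\<infinity>i. cmod (a i) * (cmod (f (x - t i)))\<^sup>2) = Re (\<Sum>\<^sub>\<infinity>i. h i x)" for x
  proof (cases "(\<lambda>i. h i x) summable_on UNIV")
    case True
    then show ?thesis using infsum_Re[OF True] by (simp add: h_def)
  next
    case False
    then have "\<not> (\<lambda>i. cmod (a i) * (cmod (f (x - t i)))\<^sup>2) summable_on UNIV"
      unfolding h_def using summable_on_of_real by blast
    then show ?thesis using False by (simp add: infsum_not_exists)
  qed
  show "AE x in lborel. (\<lambda>i. cmod (a i) * (cmod (f (x - t i)))\<^sup>2) summable_on UNIV"
    using F(1)
  proof eventually_elim
    case (elim x)
    then show ?case using summable_on_Re[OF elim] by (simp add: h_def)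
  qed
  show "integrable lborel (\<lambda>x. \<Sum>\<^sub>\<infinity>i. cmod (a i) * (cmod (f (x - t i)))\<^sup>2)"
    unfolding re using F(2) by (rule integrable_Re)
  have "(\<integral>x. (\<Sum>\<^sub>\<infinity>i. cmod (a i) * (cmod (f (x - t i)))\<^sup>2) \<partial>lborel) = Re (\<Sum>\<^sub>\<infinity>i. \<integral>x. h i x \<partial>lborel)"
    unfolding re using F(2,3) by (simp add: integral_Re)
  also have "\<dots> = (\<Sum>\<^sub>\<infinity>i. cmod (a i) * (L2norm f)\<^sup>2)"
    unfolding inth'
    by (subst infsum_Re[symmetric]) (simp_all only: Re_complex_of_real summable_on_of_real summable_on_cmult_left[OF na])
  also have "\<dots> = (\<Sum>\<^sub>\<infinity>i. cmod (a i)) * (L2norm f)\<^sup>2"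
    by (rule infsum_cmult_left') 
  finally show "(\<integral>x. (\<Sum>\<^sub>\<infinity>i. cmod (a i) * (cmod (f (x - t i)))\<^sup>2) \<partial>lborel)
           = (\<Sum>\<^sub>\<infinity>i. cmod (a i)) * (L2norm f)\<^sup>2" .
qed

text \<open>A square-integrable \<open>f\<close> need not be integrable, so Fubini is applied to the
  squares, and Cauchy-Schwarz with masses \<open>cmod (a i)\<close> returns to the first
  power.\<close>

lemma AE_abs_summable_translates:
  fixes a :: "'i \<Rightarrow> complex" and f :: "real^'d \<Rightarrow> complex"
  assumes a: "a summable_on UNIV" and f: "f \<in> L2"
  shows "AE x in lborel. (\<lambda>i. cmod (a i) * cmod (f (x - t i))) summable_on UNIV"
  using AE_summable_translates(1)[OF a f, of t]
proof eventually_elim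
  case (elim x)
  have na: "(\<lambda>i. cmod (a i)) summable_on UNIV"
    by (rule summable_on_cmod[OF a])
  show ?case by (rule infsum_abs_Cauchy_Schwarz(1)[OF na _ elim]) simp
qed

lemma summable_on_complex_bound:
  fixes g :: "'i \<Rightarrow> complex"
  assumes "b summable_on A" "\<And>i. i \<in> A \<Longrightarrow> cmod (g i) \<le> b i"
  shows "g summable_on A"
  by (rule iffD2[OF summable_on_iff_abs_summable_on_complex])
     (rule summable_on_comparison_test[OF assms(1)], auto simp: assms(2))

lemma AE_series_op_summable:
  assumes "a summable_on UNIV" "f \<in> L2"
  shows "AE x in lborel. (\<lambda>l. a l * tf_shift l f x) summable_on UNIV"
  using AE_abs_summable_translates[OF assms, of fst]
  by eventually_elim (erule summable_on_complex_bound, simp add: norm_mult cmod_tf_shift)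

lemma measurable_series_op:
  assumes "a summable_on UNIV" "f \<in> borel_measurable borel"
  shows "series_op a f \<in> borel_measurable borel"
  unfolding series_op_def
proof (rule borel_measurable_infsum_complex)
  show "countable {i. (\<lambda>x. a i * tf_shift i f x) \<noteq> (\<lambda>_. 0)}"
    by (rule countable_subset[OF _ countable_support[OF assms(1)]]) auto
  show "(\<lambda>x. a i * tf_shift i f x) \<in> borel_measurable borel" for i
    using measurable_tf_shift[OF assms(2), of i] by measurable
qed

text \<open>Cauchy-Schwarz with masses \<open>cmod (a l)\<close> bounds the squared modulus
  pointwise by \<open>S * Q x\<close>. The integral of \<open>Q\<close> is \<open>S\<close> times
  the squared norm of \<open>f\<close>, which gives the factor \<open>S\<close> after taking
  roots.\<close>

lemma series_op_L2:
  assumes a: "a summable_on UNIV" and f: "f \<in> L2"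
  shows "series_op a f \<in> L2" "L2norm (series_op a f) \<le> (\<Sum>\<^sub>\<infinity>l. cmod (a l)) * L2norm f"
proof -
  define S where "S = (\<Sum>\<^sub>\<infinity>l. cmod (a l))"
  define Q where "Q x = (\<Sum>\<^sub>\<infinity>l. cmod (a l) * (cmod (f (x - fst l)))\<^sup>2)" for x
  have S0: "0 \<le> S" unfolding S_def by (simp add: infsum_nonneg)
  have na: "(\<lambda>l. cmod (a l)) summable_on UNIV"
    by (rule summable_on_cmod[OF a])
  have bound: "AE x in lborel. (cmod (series_op a f x))\<^sup>2 \<le> S * Q x"
    using AE_summable_translates(1)[OF a f, of fst]
  proof eventually_elim
    case (elim x)
    note CS = infsum_abs_Cauchy_Schwarz[OF na norm_ge_zero elim]
    have "cmod (series_op a f x) \<le> (\<Sum>\<^sub>\<infinity>l. cmod (a l) * cmod (f (x - fst l)))"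
      using norm_infsum_bound[of "\<lambda>l. a l * tf_shift l f x" UNIV] CS(1)
      by (simp add: series_op_def norm_mult cmod_tf_shift)
    then have "(cmod (series_op a f x))\<^sup>2 \<le> (\<Sum>\<^sub>\<infinity>l. cmod (a l) * cmod (f (x - fst l)))\<^sup>2"
      by (simp add: power_mono)
    with CS(2) show ?case unfolding S_def Q_def by linarith
  qed
  have [measurable]: "series_op a f \<in> borel_measurable borel"
    by (rule measurable_series_op[OF a L2D(1)[OF f]])
  have intQ: "integrable lborel (\<lambda>x. S * Q x)"
    unfolding Q_def using AE_summable_translates(2)[OF a f, of fst] by simp
  have int: "integrable lborel (\<lambda>x. (cmod (series_op a f x))\<^sup>2)"
    by (rule Bochner_Integration.integrable_bound[OF intQ]) (use bound in \<open>auto elim: eventually_mono\<close>)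
  then show "series_op a f \<in> L2" by (simp add: L2_def)
  have "(L2norm (series_op a f))\<^sup>2 \<le> (\<integral>x. S * Q x \<partial>lborel)"
    unfolding L2norm_square using bound int intQ by (intro integral_mono_AE) auto
  also have "\<dots> = (S * L2norm f)\<^sup>2"
    using AE_summable_translates(3)[OF a f, of fst]
    by (simp add: Q_def S_def power2_eq_square)
  finally show "L2norm (series_op a f) \<le> (\<Sum>\<^sub>\<infinity>l. cmod (a l)) * L2norm f"
    using S0 unfolding S_def[symmetric] by (rule_tac power2_le_imp_le) auto
qed

text \<open>The value at one point involves all translates of \<open>f\<close>, but only those with
  \<open>a l \<noteq> 0\<close> matter. These are countably many, so the exceptional null sets have
  a null union.\<close>

lemma series_op_AE_cong:
  assumes a: "a summable_on UNIV" and fg: "f \<in> borel_measurable borel" "g \<in> borel_measurable borel"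
    and ae: "AE x in lborel. f x = g x"
  shows "AE x in lborel. series_op a f x = series_op a g x"
proof -
  have "AE x in lborel. f (x - fst l) = g (x - fst l)" for l :: "(real^'a) \<times> (real^'a)"
  proof -
    have "AE x in distr lborel borel ((+) (- fst l)). f x = g x"
      by (simp only: lborel_distr_plus ae)
    then show ?thesis
      using fg by (subst (asm) AE_distr_iff) (auto simp: add.commute[of "- fst l"])
  qed
  then have "AE x in lborel. \<forall>l\<in>{l. a l \<noteq> 0}. f (x - fst l) = g (x - fst l)"
    using countable_support[OF a] by (subst AE_ball_countable) auto
  then show ?thesis
  proof eventually_elim
    case (elim x)
    show ?case unfolding series_op_def tf_shift_def using elim by (intro infsum_cong) auto
  qed
qed

subsection \<open>Twisted convolution and operator norm\<close>

text \<open>The cocycle of the projective representation: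
  \<open>U_l U_m = phase l m * U_(l + m)\<close>.\<close>

definition phase :: "(real^'d) \<times> (real^'d) \<Rightarrow> (real^'d) \<times> (real^'d) \<Rightarrow> complex" where
  "phase l m = exp (\<i> * complex_of_real (- (snd m \<bullet> fst l)))"

text \<open>Twisted convolution, that is, the coefficients of the product of two series
  operators.\<close>

definition twconv ::
  "((real^'d) \<times> (real^'d) \<Rightarrow> complex) \<Rightarrow> ((real^'d) \<times> (real^'d) \<Rightarrow> complex) \<Rightarrow> (real^'d) \<times> (real^'d) \<Rightarrow> complex"
  where "twconv a b n = (\<Sum>\<^sub>\<infinity>l. a l * b (n - l) * phase l (n - l))"

definition opbound :: "((real^'d) \<times> (real^'d) \<Rightarrow> complex) \<Rightarrow> real \<Rightarrow> bool" where
  "opbound a K \<longleftrightarrow> 0 \<le> K \<and> (\<forall>f\<in>L2. L2norm (series_op a f) \<le> K * L2norm f)"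

definition delta :: "(real^'d) \<times> (real^'d) \<Rightarrow> complex" where
  "delta n = (if n = 0 then 1 else 0)"

lemma cmod_phase [simp]: "cmod (phase l m) = 1"
  unfolding phase_def by (rule cmod_exp_i)

lemma tf_shift_tf_shift: "tf_shift l (tf_shift m f) x = phase l m * tf_shift (l + m) f x"
proof -
  have "exp (\<i> * complex_of_real (snd l \<bullet> x)) * exp (\<i> * complex_of_real (snd m \<bullet> (x - fst l)))
      = phase l m * exp (\<i> * complex_of_real (snd (l + m) \<bullet> x))"
    unfolding phase_def exp_add[symmetric] distrib_left[symmetric] of_real_add[symmetric]
    by (simp add: inner_diff_right inner_add_left algebra_simps)
  then show ?thesis
    by (simp add: tf_shift_def diff_diff_eq)
qed

lemma summable_on_product:
  fixes u :: "'i \<Rightarrow> real" and w :: "'j \<Rightarrow> real"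
  assumes "u summable_on UNIV" "w summable_on UNIV" "\<And>i. 0 \<le> u i" "\<And>j. 0 \<le> w j"
  shows "(\<lambda>(i, j). u i * w j) summable_on UNIV"
proof -
  have "(\<lambda>(i, j). u i * w j) summable_on (UNIV \<times> UNIV)"
  proof (rule summable_on_SigmaI)
    show "((\<lambda>j. (case (i, j) of (i, j) \<Rightarrow> u i * w j)) has_sum u i * infsum w UNIV) UNIV" for i
      using assms(2) by (simp add: has_sum_cmult_right)
    show "(\<lambda>i. u i * infsum w UNIV) summable_on UNIV"
      by (rule summable_on_cmult_left[OF assms(1)])
  qed (simp add: assms)
  then show ?thesis by simp
qed

text \<open>The shear \<open>(l, m) \<mapsto> (l + m, l)\<close> is a bijection of the group
  squared, and a summable double family may be summed in any order. This regroups a product of two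
  series by the sum of the indices.\<close>

lemma infsum_shear:
  fixes F :: "'g::ab_group_add \<Rightarrow> 'g \<Rightarrow> 'c::banach"
  assumes "(\<lambda>(l, m). F l m) summable_on UNIV"
  shows "(\<lambda>n. \<Sum>\<^sub>\<infinity>l. F l (n - l)) summable_on UNIV"
    and "(\<lambda>l. F l (n - l)) summable_on UNIV"
    and "(\<Sum>\<^sub>\<infinity>n. \<Sum>\<^sub>\<infinity>l. F l (n - l)) = (\<Sum>\<^sub>\<infinity>l. \<Sum>\<^sub>\<infinity>m. F l m)"
proof -
  have s: "(\<lambda>(n, l). F l (n - l)) summable_on UNIV \<longleftrightarrow> (\<lambda>(l, m). F l m) summable_on UNIV"
    by (rule summable_on_reindex_bij_witness[where i = "\<lambda>(l, m). (l + m, l)" and j = "\<lambda>(n, l). (l, n - l)"]) auto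
  then have s': "(\<lambda>(n, l). F l (n - l)) summable_on (UNIV \<times> UNIV)" using assms by simp
  show "(\<lambda>n. \<Sum>\<^sub>\<infinity>l. F l (n - l)) summable_on UNIV"
    using summable_on_Sigma_banach[OF s'] .
  show "(\<lambda>l. F l (n - l)) summable_on UNIV"
  proof -
    have "(\<lambda>(n, l). F l (n - l)) summable_on (Pair n ` UNIV)"
      using s' by (rule summable_on_subset_banach) simp
    then show ?thesis
      by (subst (asm) summable_on_reindex) (auto simp: inj_on_def o_def)
  qed
  have "(\<Sum>\<^sub>\<infinity>n. \<Sum>\<^sub>\<infinity>l. F l (n - l)) = infsum (\<lambda>(n, l). F l (n - l)) (UNIV \<times> UNIV)"
    by (rule infsum_Sigma'_banach[OF s'])
  also have "\<dots> = infsum (\<lambda>(l, m). F l m) (UNIV \<times> UNIV)"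
    by (rule infsum_reindex_bij_witness[where i = "\<lambda>(l, m). (l + m, l)" and j = "\<lambda>(n, l). (l, n - l)"]) auto
  also have "\<dots> = (\<Sum>\<^sub>\<infinity>l. \<Sum>\<^sub>\<infinity>m. F l m)"
    by (rule infsum_Sigma'_banach[symmetric]) (use assms in simp)
  finally show "(\<Sum>\<^sub>\<infinity>n. \<Sum>\<^sub>\<infinity>l. F l (n - l)) = (\<Sum>\<^sub>\<infinity>l. \<Sum>\<^sub>\<infinity>m. F l m)" .
qed

text \<open>Submultiplicativity splits the weight \<open>v n\<close> over the factors as
  \<open>v l * v (n - l)\<close>.\<close>

lemma in_Av_twconv:
  assumes v: "\<And>x. 0 \<le> v x" "\<And>x y. v (x + y) \<le> v x * v y"
    and a: "in_Av v a" and b: "in_Av v b"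
  shows "in_Av v (twconv a b)"
proof -
  define F where "F l m = (v l * cmod (a l)) * (v m * cmod (b m))" for l m
  have "(\<lambda>(l, m). F l m) summable_on UNIV"
    unfolding F_def using a b by (intro summable_on_product) (auto simp: in_Av_def v(1))
  note S = infsum_shear[OF this]
  have "v n * cmod (twconv a b n) \<le> (\<Sum>\<^sub>\<infinity>l. F l (n - l))" for n
  proof -
    have le: "cmod (v n *\<^sub>R (a l * b (n - l) * phase l (n - l))) \<le> F l (n - l)" for l
      using mult_right_mono[OF v(2)[of l "n - l"], of "cmod (a l * b (n - l))"]
      by (simp add: F_def norm_mult v(1) mult_ac)
    have "v n * cmod (twconv a b n) = cmod (\<Sum>\<^sub>\<infinity>l. v n *\<^sub>R (a l * b (n - l) * phase l (n - l)))"
      by (simp add: twconv_def infsum_scaleR_right v(1))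
    also have "\<dots> \<le> (\<Sum>\<^sub>\<infinity>l. F l (n - l))"
      by (rule norm_infsum_le[OF _ _ le])
         (use S(2)[of n] le in \<open>auto intro!: has_sum_infsum intro: summable_on_complex_bound\<close>)
    finally show ?thesis .
  qed
  then show ?thesis
    unfolding in_Av_def by (intro summable_on_comparison_test[OF S(1)]) (auto simp: v(1))
qed

lemma in_Av_1: "in_Av (\<lambda>_. 1) a \<longleftrightarrow> a summable_on UNIV"
  using summable_on_iff_abs_summable_on_complex[of a UNIV] by (simp add: in_Av_def)

lemma summable_on_twconv:
  assumes "a summable_on UNIV" "b summable_on UNIV"
  shows "twconv a b summable_on UNIV"
  using in_Av_twconv[of "\<lambda>_. 1" a b] assms by (simp add: in_Av_1)

text \<open>For almost every \<open>x\<close> the double family indexed by \<open>(l, m)\<close> is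
  absolutely summable, so it can be regrouped along \<open>n = l + m\<close>.\<close>

lemma series_op_twconv:
  assumes a: "a summable_on UNIV" and b: "b summable_on UNIV" and f: "f \<in> L2"
  shows "AE x in lborel. series_op a (series_op b f) x = series_op (twconv a b) f x"
proof -
  have ab: "(\<lambda>(l, m). a l * b m) summable_on UNIV"
    by (rule summable_on_complex_bound[OF summable_on_product[OF summable_on_cmod[OF a] summable_on_cmod[OF b]]])
       (auto simp: norm_mult)
  show ?thesis
    using AE_abs_summable_translates[OF ab f, of "\<lambda>(l, m). fst l + fst m"]
  proof eventually_elim
    case (elim x)
    define F where "F l m = a l * b m * phase l m * tf_shift (l + m) f x" for l m
    have "(\<lambda>(l, m). F l m) summable_on UNIV"
      by (rule summable_on_complex_bound[OF elim]) (auto simp: F_def norm_mult cmod_tf_shift)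
    note S = infsum_shear(3)[OF this]
    have "series_op a (series_op b f) x = (\<Sum>\<^sub>\<infinity>l. \<Sum>\<^sub>\<infinity>m. F l m)"
    proof -
      have "a l * tf_shift l (series_op b f) x = (\<Sum>\<^sub>\<infinity>m. F l m)" for l
      proof -
        have "F l m = a l * exp (\<i> * complex_of_real (snd l \<bullet> x)) * (b m * tf_shift m f (x - fst l))" for m
          using tf_shift_tf_shift[of l m f x] by (simp add: F_def tf_shift_def[of l] mult_ac)
        then show ?thesis
          by (simp add: infsum_cmult_right' series_op_def tf_shift_def[of l] mult.assoc)
      qed
      then show ?thesis by (simp add: series_op_def[of a])
    qed
    also have "\<dots> = (\<Sum>\<^sub>\<infinity>n. \<Sum>\<^sub>\<infinity>l. F l (n - l))" using S ..
    also have "\<dots> = series_op (twconv a b) f x"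
      by (simp add: F_def series_op_def twconv_def infsum_cmult_left')
    finally show ?case .
  qed
qed

lemma summable_on_finite_support:
  assumes "finite {l. a l \<noteq> 0}"
  shows "a summable_on UNIV"
  by (rule finite_nonzero_values_imp_summable_on) (use assms in simp)

lemma series_op_scale: "series_op (\<lambda>l. c * a l) f x = c * series_op a f x"
  by (simp add: series_op_def mult.assoc infsum_cmult_right')

lemma series_op_add:
  assumes a: "a summable_on UNIV" and b: "b summable_on UNIV" and f: "f \<in> L2"
  shows "AE x in lborel. series_op (\<lambda>l. a l + b l) f x = series_op a f x + series_op b f x"
  using AE_series_op_summable[OF a f] AE_series_op_summable[OF b f]
  by eventually_elim (simp add: series_op_def distrib_right infsum_add)

lemma series_op_diff:
  assumes a: "a summable_on UNIV" and b: "b summable_on UNIV" and f: "f \<in> L2"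
  shows "AE x in lborel. series_op (\<lambda>l. a l - b l) f x = series_op a f x - series_op b f x"
proof -
  have "(\<lambda>l. (- 1) * b l) summable_on UNIV" by (rule summable_on_cmult_right[OF b])
  from series_op_add[OF a this f] show ?thesis
    unfolding series_op_scale by simp
qed

lemma series_op_single:
  assumes "\<And>l. l \<noteq> n \<Longrightarrow> a l = 0"
  shows "series_op a f x = a n * tf_shift n f x"
proof -
  have "series_op a f x = infsum (\<lambda>l. a l * tf_shift l f x) {n}"
    unfolding series_op_def by (rule infsum_cong_neutral) (auto simp: assms)
  then show ?thesis by simp
qed

lemma series_op_delta: "series_op delta f = f"
proof
  fix x
  show "series_op delta f x = f x"
    using series_op_single[of 0 delta f x] by (simp add: delta_def tf_shift_def)
qed

lemma opboundD: "opbound a K \<Longrightarrow> f \<in> L2 \<Longrightarrow> L2norm (series_op a f) \<le> K * L2norm f"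
  by (simp add: opbound_def)

lemma opbound_l1:
  assumes "a summable_on UNIV"
  shows "opbound a (\<Sum>\<^sub>\<infinity>l. cmod (a l))"
  unfolding opbound_def using series_op_L2(2)[OF assms] by (auto intro: infsum_nonneg)

lemma opbound_delta: "opbound delta 1"
  by (simp add: opbound_def series_op_delta)

lemma opbound_mono: "opbound a K \<Longrightarrow> K \<le> L \<Longrightarrow> opbound a L"
  unfolding opbound_def by (meson L2norm_nonneg mult_right_mono order_trans)

lemma opbound_scale:
  assumes "a summable_on UNIV" "opbound a K"
  shows "opbound (\<lambda>l. c * a l) (cmod c * K)"
  using assms L2_scale(2)[OF series_op_L2(1)[OF assms(1)], of _ c]
  by (auto simp: opbound_def series_op_scale[abs_def] mult.assoc intro!: mult_left_mono)

lemma opbound_add: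
  assumes a: "a summable_on UNIV" "opbound a K" and b: "b summable_on UNIV" "opbound b L"
  shows "opbound (\<lambda>l. a l + b l) (K + L)"
  unfolding opbound_def
proof (intro conjI ballI)
  show "0 \<le> K + L" using a b by (simp add: opbound_def)
  fix f :: "real^'a \<Rightarrow> complex" assume f: "f \<in> L2"
  have ab: "(\<lambda>l. a l + b l) summable_on UNIV" by (rule summable_on_add[OF a(1) b(1)])
  have s: "(\<lambda>x. series_op a f x + series_op b f x) \<in> L2"
    "L2norm (\<lambda>x. series_op a f x + series_op b f x) \<le> L2norm (series_op a f) + L2norm (series_op b f)"
    by (rule L2_add[OF series_op_L2(1)[OF a(1) f] series_op_L2(1)[OF b(1) f]])+
  have "L2norm (\<lambda>x. series_op a f x + series_op b f x) = L2norm (series_op (\<lambda>l. a l + b l) f)"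
    by (rule L2_AE_cong(2)[OF series_op_L2(1)[OF ab f] L2D(1)[OF s(1)] series_op_add[OF a(1) b(1) f]])
  then show "L2norm (series_op (\<lambda>l. a l + b l) f) \<le> (K + L) * L2norm f"
    using s(2) opboundD[OF a(2) f] opboundD[OF b(2) f] by (simp add: distrib_right)
qed

lemma opbound_twconv:
  assumes a: "a summable_on UNIV" "opbound a K" and b: "b summable_on UNIV" "opbound b L"
  shows "opbound (twconv a b) (K * L)"
  unfolding opbound_def
proof (intro conjI ballI)
  show "0 \<le> K * L" using a b by (simp add: opbound_def)
  fix f :: "real^'a \<Rightarrow> complex" assume f: "f \<in> L2"
  note bf = series_op_L2(1)[OF b(1) f]
  have "L2norm (series_op (twconv a b) f) = L2norm (series_op a (series_op b f))"
    by (rule L2_AE_cong(2)[OF series_op_L2(1)[OF a(1) bf] _ series_op_twconv[OF a(1) b(1) f]])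
       (rule L2D(1)[OF series_op_L2(1)[OF summable_on_twconv[OF a(1) b(1)] f]])
  also have "\<dots> \<le> K * (L * L2norm f)"
    using opboundD[OF a(2) bf] mult_left_mono[OF opboundD[OF b(2) f], of K] a(2)
    by (simp add: opbound_def)
  finally show "L2norm (series_op (twconv a b) f) \<le> K * L * L2norm f" by (simp add: mult.assoc)
qed

text \<open>Composing with \<open>c * U_m\<close> on the left translates the coefficients by
  \<open>m\<close>, up to a phase. A twisted convolution is a superposition of such
  translates.\<close>

lemma series_op_translate:
  "series_op (\<lambda>n. c * x (n - m) * phase m (n - m)) f y = c * tf_shift m (series_op x f) y"
proof -
  have "series_op (\<lambda>n. c * x (n - m) * phase m (n - m)) f y
      = (\<Sum>\<^sub>\<infinity>l. c * x l * phase m l * tf_shift (m + l) f y)"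
    unfolding series_op_def
    by (rule infsum_reindex_bij_witness[where i = "\<lambda>l. m + l" and j = "\<lambda>n. n - m"]) auto
  also have "\<dots> = (\<Sum>\<^sub>\<infinity>l. c * exp (\<i> * complex_of_real (snd m \<bullet> y)) * (x l * tf_shift l f (y - fst m)))"
  proof (rule infsum_cong)
    fix l
    show "c * x l * phase m l * tf_shift (m + l) f y
        = c * exp (\<i> * complex_of_real (snd m \<bullet> y)) * (x l * tf_shift l f (y - fst m))"
      using tf_shift_tf_shift[of m l f y] by (simp add: tf_shift_def[of m] mult_ac)
  qed
  also have "\<dots> = c * tf_shift m (series_op x f) y"
    by (simp add: infsum_cmult_right' series_op_def tf_shift_def[of m] mult.assoc)
  finally show ?thesis .
qed

lemma opbound_translate:
  assumes x: "x summable_on UNIV" "opbound x K"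
  shows "opbound (\<lambda>n. c * x (n - m) * phase m (n - m)) (cmod c * K)"
  unfolding opbound_def
proof (intro conjI ballI)
  show "0 \<le> cmod c * K" using x by (simp add: opbound_def)
  fix f :: "real^'a \<Rightarrow> complex" assume f: "f \<in> L2"
  note xf = series_op_L2(1)[OF x(1) f]
  have "L2norm (series_op (\<lambda>n. c * x (n - m) * phase m (n - m)) f) = cmod c * L2norm (series_op x f)"
    unfolding series_op_translate[abs_def] using L2_scale(2)[OF tf_shift_L2(1)[OF xf]] tf_shift_L2(2)[OF xf] by simp
  also have "\<dots> \<le> cmod c * (K * L2norm f)"
    by (intro mult_left_mono opboundD[OF x(2) f]) simp
  finally show "L2norm (series_op (\<lambda>n. c * x (n - m) * phase m (n - m)) f) \<le> cmod c * K * L2norm f"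
    by (simp add: mult.assoc)
qed

section \<open>Coefficients are bounded by the operator norm\<close>

lemma box_function_L2:
  defines "u \<equiv> (\<lambda>x :: real^'d. complex_of_real (indicator (cbox 0 One) x))"
  shows "u \<in> L2" "L2norm u = 1"
proof -
  have sq: "(cmod (u x))\<^sup>2 = indicator (cbox 0 One) x" for x
    by (simp add: u_def indicator_def)
  have "emeasure lborel (cbox 0 One :: (real^'d) set) < \<infinity>"
    by (simp add: emeasure_lborel_cbox_eq)
  moreover have "measure lborel (cbox 0 One :: (real^'d) set) = 1"
    by (subst measure_lborel_cbox) auto
  ultimately show "u \<in> L2" "L2norm u = 1"
    by (auto simp: L2_def L2norm_def sq integrable_indicator_iff) (simp add: u_def)
qed

text \<open>The symplectic form of phase space, which governs commutation:
  \<open>U_l U_m = exp (\<i> * comm_angle m l) * U_m U_l\<close>.\<close>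

definition comm_angle :: "(real^'d) \<times> (real^'d) \<Rightarrow> (real^'d) \<times> (real^'d) \<Rightarrow> real" where
  "comm_angle m l = snd l \<bullet> fst m - snd m \<bullet> fst l"

lemma phase_commute: "phase l m = exp (\<i> * complex_of_real (comm_angle m l)) * phase m l"
  unfolding phase_def comm_angle_def exp_add[symmetric] distrib_left[symmetric] of_real_add[symmetric]
  by simp

lemma series_op_modulate:
  "series_op x (tf_shift m f) y
     = tf_shift m (series_op (\<lambda>l. exp (\<i> * complex_of_real (comm_angle m l)) * x l) f) y"
proof -
  have "tf_shift m (series_op (\<lambda>l. exp (\<i> * complex_of_real (comm_angle m l)) * x l) f) y
     = (\<Sum>\<^sub>\<infinity>l. exp (\<i> * complex_of_real (snd m \<bullet> y)) *
          (exp (\<i> * complex_of_real (comm_angle m l)) * x l * tf_shift l f (y - fst m)))"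
    by (simp add: infsum_cmult_right' series_op_def tf_shift_def[of m])
  also have "\<dots> = (\<Sum>\<^sub>\<infinity>l. x l * tf_shift l (tf_shift m f) y)"
  proof (rule infsum_cong)
    fix l
    show "exp (\<i> * complex_of_real (snd m \<bullet> y)) *
          (exp (\<i> * complex_of_real (comm_angle m l)) * x l * tf_shift l f (y - fst m))
        = x l * tf_shift l (tf_shift m f) y"
      using tf_shift_tf_shift[of m l f y]
      by (simp add: tf_shift_tf_shift[of l m f y] tf_shift_def[of m] phase_commute[of l m] add.commute[of l m] mult_ac)
  qed
  finally show ?thesis by (simp add: series_op_def)
qed

text \<open>Conjugation by the unitary \<open>U_m\<close> multiplies each coefficient by a character
  of the index. The further constant factor of modulus 1 normalises this character to be 1 at
  \<open>n\<close>.\<close>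

lemma opbound_modulate:
  assumes x: "x summable_on UNIV" "opbound x K"
  shows "opbound (\<lambda>l. exp (\<i> * complex_of_real (comm_angle m (l - n))) * x l) K"
proof -
  define y where "y l = exp (\<i> * complex_of_real (comm_angle m l)) * x l" for l
  have ys: "y summable_on UNIV"
    unfolding y_def by (rule summable_on_complex_bound[OF summable_on_cmod[OF x(1)]]) (simp add: norm_mult)
  have "opbound y K"
    unfolding opbound_def
  proof (intro conjI ballI)
    show "0 \<le> K" using x(2) by (simp add: opbound_def)
    fix f :: "real^'a \<Rightarrow> complex" assume f: "f \<in> L2"
    have "series_op x (tf_shift m f) = tf_shift m (series_op y f)"
      by (simp add: fun_eq_iff series_op_modulate y_def[abs_def])
    then have "L2norm (series_op y f) = L2norm (series_op x (tf_shift m f))"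
      using tf_shift_L2(2)[OF series_op_L2(1)[OF ys f], of m] by simp
    also have "\<dots> \<le> K * L2norm f"
      using opboundD[OF x(2) tf_shift_L2(1)[OF f]] tf_shift_L2(2)[OF f] by simp
    finally show "L2norm (series_op y f) \<le> K * L2norm f" .
  qed
  then have "opbound (\<lambda>l. exp (\<i> * complex_of_real (- comm_angle m n)) * y l)
      (cmod (exp (\<i> * complex_of_real (- comm_angle m n))) * K)"
    by (rule opbound_scale[OF ys])
  moreover have "exp (\<i> * complex_of_real (- comm_angle m n)) * y l
      = exp (\<i> * complex_of_real (comm_angle m (l - n))) * x l" for l
    unfolding y_def mult.assoc[symmetric] exp_add[symmetric] distrib_left[symmetric] of_real_add[symmetric]
    by (simp add: comm_angle_def inner_diff_right inner_diff_left algebra_simps)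
  ultimately show ?thesis by (simp only: cmod_exp_i mult_1)
qed

text \<open>Averaging an operator with a conjugate by a time-frequency shift, the phases being chosen to
  be opposite, removes one term of its expansion without increasing the norm.\<close>

lemma coeff_le_opbound:
  fixes x :: "(real^'d) \<times> (real^'d) \<Rightarrow> complex"
  assumes "finite {l. x l \<noteq> 0}" "opbound x K"
  shows "cmod (x n) \<le> K"
proof -
  \<comment> \<open>Support points other than \<open>n\<close> are removed one at a time. The claim
    is for all \<open>x\<close>, since each step replaces \<open>x\<close> by an average.\<close>
  have "finite S \<Longrightarrow> {l. x l \<noteq> 0} \<subseteq> insert n S \<Longrightarrow> opbound x K \<Longrightarrow> cmod (x n) \<le> K"
    for S and x :: "(real^'d) \<times> (real^'d) \<Rightarrow> complex"
  proof (induction S arbitrary: x rule: finite_induct)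
    case empty
    \<comment> \<open>With only the coefficient at \<open>n\<close> left, the operator is a multiple
      of a unitary, and any unit vector detects the factor.\<close>
    define u :: "real^'d \<Rightarrow> complex" where "u = (\<lambda>x. complex_of_real (indicator (cbox 0 One) x))"
    have u: "u \<in> L2" "L2norm u = 1" unfolding u_def by (rule box_function_L2)+
    have "series_op x u = (\<lambda>y. x n * tf_shift n u y)"
      using empty.prems(1) by (intro ext series_op_single) auto
    then have "L2norm (series_op x u) = cmod (x n)"
      using L2_scale(2)[OF tf_shift_L2(1)[OF u(1)], of "x n" n] tf_shift_L2(2)[OF u(1), of n] u(2) by simp
    then show ?case using opboundD[OF empty.prems(2) u(1)] u(2) by simp
  next
    case (insert l S)
    show ?case
    proof (cases "l = n")
      case True
      then show ?thesis using insert.IH[OF _ insert.prems(2)] insert.prems(1) by simp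
    next
      case False
      define D where "D = l - n"
      have D: "D \<noteq> 0" using False by (simp add: D_def)
      \<comment> \<open>A multiple of the symplectic rotation of \<open>D\<close>, scaled so that
        the commutation phase at \<open>l\<close> is exactly -1.\<close>
      define m where "m = (pi / (norm D)\<^sup>2) *\<^sub>R (snd D, - fst D)"
      have nD: "(norm D)\<^sup>2 = snd D \<bullet> snd D + fst D \<bullet> fst D"
        by (simp add: power2_norm_eq_inner inner_prod_def)
      have "comm_angle m D = (pi / (norm D)\<^sup>2) * (norm D)\<^sup>2"
        by (simp add: comm_angle_def m_def nD distrib_left)
      then have ang: "comm_angle m D = pi" using D by simp
      have xs: "x summable_on UNIV"
        by (rule summable_on_finite_support)
           (rule finite_subset[OF insert.prems(1)], use insert.hyps in simp)
      define y where "y k = exp (\<i> * complex_of_real (comm_angle m (k - n))) * x k" for k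
      have ys: "y summable_on UNIV"
        unfolding y_def by (rule summable_on_complex_bound[OF summable_on_cmod[OF xs]]) (simp add: norm_mult)
      have yb: "opbound y K"
        unfolding y_def by (rule opbound_modulate[OF xs insert.prems(2)])
      \<comment> \<open>In the average, the terms at \<open>l\<close> cancel and the terms at
        \<open>n\<close> agree.\<close>
      define z where "z k = (1/2) * (x k + y k)" for k
      have "opbound z (cmod (1/2) * (K + K))"
        unfolding z_def by (rule opbound_scale[OF summable_on_add[OF xs ys] opbound_add[OF xs insert.prems(2) ys yb]])
      then have zb: "opbound z K" by simp
      have zn: "z n = x n" by (simp add: z_def y_def comm_angle_def)
      have zl: "z l = 0" using ang by (simp add: z_def y_def D_def[symmetric] exp_pi_i')
      have "{k. z k \<noteq> 0} \<subseteq> insert n S"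
      proof
        fix k assume "k \<in> {k. z k \<noteq> 0}"
        then have "z k \<noteq> 0" by simp
        then have "k \<noteq> l" "x k \<noteq> 0" using zl by (auto simp: z_def y_def)
        then show "k \<in> insert n S" using insert.prems(1) by auto
      qed
      from insert.IH[OF this zb] show ?thesis by (simp add: zn)
    qed
  qed
  from this[OF assms(1) _ assms(2)] show ?thesis by blast
qed

subsection \<open>Powers in the weighted algebra\<close>

text \<open>The superpositions of operators whose coefficients live on a translate of \<open>B\<close>, each
  piece being measured by its operator norm. Convolution only moves the translates around, since the
  index group is commutative.\<close>

inductive gauge_le ::
  "((real^'d) \<times> (real^'d) \<Rightarrow> real) \<Rightarrow> ((real^'d) \<times> (real^'d)) set \<Rightarrow> real \<Rightarrow>
   ((real^'d) \<times> (real^'d) \<Rightarrow> complex) \<Rightarrow> bool"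
  for v B where
  atom: "{n. x n \<noteq> 0} \<subseteq> (+) l ` B \<Longrightarrow> opbound x K \<Longrightarrow> v l * K \<le> r \<Longrightarrow> gauge_le v B r x"
| add: "gauge_le v B r x \<Longrightarrow> gauge_le v B s y \<Longrightarrow> r + s \<le> t \<Longrightarrow> gauge_le v B t (\<lambda>n. x n + y n)"
| sum: "(\<And>i :: (real^'d) \<times> (real^'d). gauge_le v B (r i) (x i)) \<Longrightarrow> r summable_on UNIV \<Longrightarrow>
    infsum r UNIV \<le> t \<Longrightarrow> gauge_le v B t (\<lambda>n. \<Sum>\<^sub>\<infinity>i. x i n)"

text \<open>A divergent sum has the value 0 here, so upper bounds for \<open>wnorm\<close> are
  meaningful only together with \<open>in_Av\<close>.\<close>

definition wnorm where "wnorm v x = (\<Sum>\<^sub>\<infinity>n. v n * cmod (x n))"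

text \<open>Summation over \<open>i\<close> and \<open>n\<close> is interchanged for the nonnegative
  terms \<open>v n * cmod (x i n)\<close>. Since \<open>v\<close> is at least 1, these also dominate
  the unweighted double family.\<close>

lemma wnorm_infsum_le:
  fixes x :: "'i \<Rightarrow> (real^'d) \<times> (real^'d) \<Rightarrow> complex"
  assumes v: "\<And>x. 1 \<le> v x" and x: "\<And>i. in_Av v (x i)" "\<And>i. wnorm v (x i) \<le> r i"
    and r: "r summable_on UNIV"
  shows "in_Av v (\<lambda>n. \<Sum>\<^sub>\<infinity>i. x i n)" "wnorm v (\<lambda>n. \<Sum>\<^sub>\<infinity>i. x i n) \<le> infsum r UNIV"
    "(\<lambda>(i, n). x i n) summable_on UNIV"
proof -
  have v0: "0 \<le> v n" for n using v[of n] by linarith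
  define F where "F i n = v n * cmod (x i n)" for i n
  have F0: "0 \<le> F i n" for i n by (simp add: F_def v0)
  have Fs: "F i summable_on UNIV" for i using x(1)[of i] by (simp add: F_def[abs_def] in_Av_def)
  have w: "infsum (F i) UNIV = wnorm v (x i)" for i by (simp add: F_def[abs_def] wnorm_def)
  have ws: "(\<lambda>i. wnorm v (x i)) summable_on UNIV"
    by (rule summable_on_comparison_test[OF r x(2)]) (auto simp: wnorm_def v0 infsum_nonneg)
  have sF: "(\<lambda>(i, n). F i n) summable_on (UNIV \<times> UNIV)"
  proof (rule summable_on_SigmaI)
    show "((\<lambda>n. case (i, n) of (i, n) \<Rightarrow> F i n) has_sum wnorm v (x i)) UNIV" for i
      using Fs[of i] by (simp add: w[symmetric])
  qed (auto simp: ws F0)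
  then have sF': "(\<lambda>(n, i). F i n) summable_on (UNIV \<times> UNIV)"
    using summable_on_swap[of "\<lambda>(i, n). F i n" UNIV UNIV] by simp
  have le: "cmod (x i n) \<le> F i n" for i n
    using mult_right_mono[OF v[of n], of "cmod (x i n)"] by (simp add: F_def)
  show "(\<lambda>(i, n). x i n) summable_on UNIV"
    using sF by (rule_tac summable_on_complex_bound[where b = "\<lambda>(i, n). F i n"]) (auto simp: le)
  have Fn: "(\<lambda>i. F i n) summable_on UNIV" for n
    using summable_on_SigmaD1[OF sF', of n] by simp
  have G: "(\<lambda>n. \<Sum>\<^sub>\<infinity>i. F i n) summable_on UNIV"
    using summable_on_Sigma_banach[OF sF'] .
  have pt: "v n * cmod (\<Sum>\<^sub>\<infinity>i. x i n) \<le> (\<Sum>\<^sub>\<infinity>i. F i n)" for n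
  proof -
    have le': "cmod (v n *\<^sub>R x i n) \<le> F i n" for i by (simp add: F_def v0)
    have "v n * cmod (\<Sum>\<^sub>\<infinity>i. x i n) = cmod (\<Sum>\<^sub>\<infinity>i. v n *\<^sub>R x i n)"
      by (simp add: infsum_scaleR_right v0)
    also have "\<dots> \<le> (\<Sum>\<^sub>\<infinity>i. F i n)"
      by (rule norm_infsum_le[OF _ _ le'])
         (use Fn[of n] le' in \<open>auto intro!: has_sum_infsum intro: summable_on_complex_bound\<close>)
    finally show ?thesis .
  qed
  show inA: "in_Av v (\<lambda>n. \<Sum>\<^sub>\<infinity>i. x i n)"
    unfolding in_Av_def by (rule summable_on_comparison_test[OF G pt]) (simp add: v0)
  have "wnorm v (\<lambda>n. \<Sum>\<^sub>\<infinity>i. x i n) \<le> (\<Sum>\<^sub>\<infinity>n. \<Sum>\<^sub>\<infinity>i. F i n)"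
    unfolding wnorm_def using inA G pt by (intro infsum_mono) (auto simp: in_Av_def)
  also have "\<dots> = (\<Sum>\<^sub>\<infinity>i. \<Sum>\<^sub>\<infinity>n. F i n)"
    by (rule infsum_swap_banach[OF sF'])
  also have "\<dots> \<le> infsum r UNIV"
    unfolding w using ws r x(2) by (intro infsum_mono) auto
  finally show "wnorm v (\<lambda>n. \<Sum>\<^sub>\<infinity>i. x i n) \<le> infsum r UNIV" .
qed

lemma in_Av_summable:
  assumes "\<And>x. 1 \<le> v x" "in_Av v a"
  shows "a summable_on UNIV"
  by (rule summable_on_complex_bound[of "\<lambda>l. v l * cmod (a l)"])
     (use assms mult_right_mono[OF assms(1), of "cmod (a _)"] in \<open>auto simp: in_Av_def\<close>)

lemma infsum_cmod_le_wnorm: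
  assumes "\<And>x. 1 \<le> v x" "in_Av v a"
  shows "(\<Sum>\<^sub>\<infinity>l. cmod (a l)) \<le> wnorm v a"
  unfolding wnorm_def
  using assms(2) summable_on_cmod[OF in_Av_summable[OF assms]] mult_right_mono[OF assms(1), of "cmod (a _)"]
  by (intro infsum_mono) (auto simp: in_Av_def)

lemma finite_translate_support:
  fixes B :: "'g::ab_group_add set"
  assumes "finite B" "{n. x n \<noteq> 0} \<subseteq> (+) l ` B"
  shows "finite {n. x n \<noteq> 0}"
  using assms finite_subset by blast

text \<open>An atom has at most \<open>card B\<close> coefficients, each bounded by its operator
  bound and carrying weight at most \<open>v l * W\<close>. The resulting factor does not depend on
  the atom, so it survives sums and series.\<close>

lemma gauge_le_imp_wnorm_le:
  assumes v: "\<And>x. 1 \<le> v x" "\<And>x y. v (x + y) \<le> v x * v y"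
    and B: "finite B" "\<And>b. b \<in> B \<Longrightarrow> v b \<le> W" and W: "0 \<le> W"
    and x: "gauge_le v B r x"
  shows "in_Av v x \<and> wnorm v x \<le> real (card B) * W * r"
  using x
proof induction
  case (atom x l K r)
  have v0: "0 \<le> v n" for n using v(1)[of n] by linarith
  have fin: "finite {n. x n \<noteq> 0}" using B(1) atom(1) by (rule finite_translate_support)
  have K: "0 \<le> K" using atom(2) by (simp add: opbound_def)
  have "in_Av v x"
    unfolding in_Av_def by (rule finite_nonzero_values_imp_summable_on) (rule finite_subset[OF _ fin], auto)
  moreover have "wnorm v x \<le> real (card B) * W * r"
  proof -
    have "wnorm v x = infsum (\<lambda>n. v n * cmod (x n)) ((+) l ` B)"
      unfolding wnorm_def using atom(1) by (intro infsum_cong_neutral) auto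
    also have "\<dots> = (\<Sum>b\<in>B. v (l + b) * cmod (x (l + b)))"
      using B(1) by (simp add: sum.reindex)
    also have "\<dots> \<le> (\<Sum>b\<in>B. (v l * W) * K)"
    proof (rule sum_mono)
      fix b assume b: "b \<in> B"
      have "v (l + b) \<le> v l * W"
        using v(2)[of l b] mult_left_mono[OF B(2)[OF b] v0[of l]] by linarith
      then show "v (l + b) * cmod (x (l + b)) \<le> (v l * W) * K"
        using coeff_le_opbound[OF fin atom(2)] v0 W by (intro mult_mono) auto
    qed
    also have "\<dots> = real (card B) * W * (v l * K)" by simp
    also have "\<dots> \<le> real (card B) * W * r"
      using atom(3) W by (intro mult_left_mono) auto
    finally show ?thesis .
  qed
  ultimately show ?case by simp
next
  case (add r x s y t)
  have v0: "0 \<le> v n" for n using v(1)[of n] by linarith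
  have s: "(\<lambda>n. v n * cmod (x n) + v n * cmod (y n)) summable_on UNIV"
    using add.IH by (intro summable_on_add) (auto simp: in_Av_def)
  have le: "v n * cmod (x n + y n) \<le> v n * cmod (x n) + v n * cmod (y n)" for n
    using mult_left_mono[OF norm_triangle_ineq[of "x n" "y n"] v0[of n]] by (simp add: distrib_left)
  have i: "in_Av v (\<lambda>n. x n + y n)"
    unfolding in_Av_def by (rule summable_on_comparison_test[OF s le]) (simp add: v0)
  have "wnorm v (\<lambda>n. x n + y n) \<le> wnorm v x + wnorm v y"
    unfolding wnorm_def using add.IH i s le
    by (subst infsum_add[symmetric]) (auto simp: in_Av_def intro!: infsum_mono)
  also have "\<dots> \<le> real (card B) * W * (r + s)"
    using add.IH by (simp add: distrib_left)
  also have "\<dots> \<le> real (card B) * W * t"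
    using add.hyps(3) W by (intro mult_left_mono) auto
  finally show ?case using i by simp
next
  case (sum r x t)
  have s: "(\<lambda>i. real (card B) * W * r i) summable_on UNIV"
    by (rule summable_on_cmult_right[OF sum.hyps(2)])
  have i: "in_Av v (\<lambda>n. \<Sum>\<^sub>\<infinity>i. x i n)"
    by (rule wnorm_infsum_le(1)[OF v(1) _ _ s]) (use sum.IH in auto)
  have "wnorm v (\<lambda>n. \<Sum>\<^sub>\<infinity>i. x i n) \<le> (\<Sum>\<^sub>\<infinity>i. real (card B) * W * r i)"
    by (rule wnorm_infsum_le(2)[OF v(1) _ _ s]) (use sum.IH in auto)
  also have "(\<Sum>\<^sub>\<infinity>i. real (card B) * W * r i) = real (card B) * W * infsum r UNIV"
    by (rule infsum_cmult_right')
  also have "\<dots> \<le> real (card B) * W * t"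
    using sum.hyps(3) W by (intro mult_left_mono) auto
  finally show ?case using i by simp
qed

lemma gauge_le_mono_set:
  assumes "gauge_le v B r x" "B \<subseteq> B'"
  shows "gauge_le v B' r x"
  using assms(1)
proof induction
  case (atom x l K r)
  then show ?case using assms(2) by (intro gauge_le.atom[of x l B' K v r]) auto
next
  case (add r x s y t)
  then show ?case by (intro gauge_le.add)
next
  case (sum r x t)
  then show ?case by (intro gauge_le.sum)
qed

text \<open>An atom centred at \<open>l\<close> becomes one centred at \<open>m + l\<close> with the
  same shape \<open>B\<close>, since shifts are unitary. Submultiplicativity charges
  \<open>v m\<close> for the move.\<close>

lemma gauge_le_translate:
  assumes v: "\<And>x. 0 \<le> v x" "\<And>x y. v (x + y) \<le> v x * v y" and B: "finite B"
    and x: "gauge_le v B r x"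
  shows "gauge_le v B (cmod c * v m * r) (\<lambda>n. c * x (n - m) * phase m (n - m))"
  using x
proof induction
  case (atom x l K r)
  have fin: "finite {n. x n \<noteq> 0}" using B atom(1) by (rule finite_translate_support)
  have K: "0 \<le> K" using atom(2) by (simp add: opbound_def)
  show ?case
  proof (rule gauge_le.atom[of _ "m + l" _ "cmod c * K"])
    show "{n. c * x (n - m) * phase m (n - m) \<noteq> 0} \<subseteq> (+) (m + l) ` B"
    proof
      fix n assume "n \<in> {n. c * x (n - m) * phase m (n - m) \<noteq> 0}"
      then have "n - m \<in> (+) l ` B" using atom(1) by auto
      then obtain b where "b \<in> B" "n - m = l + b" by auto
      then show "n \<in> (+) (m + l) ` B" by (intro image_eqI[of _ _ b]) (auto simp: algebra_simps)
    qed
    show "opbound (\<lambda>n. c * x (n - m) * phase m (n - m)) (cmod c * K)"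
      by (rule opbound_translate[OF summable_on_finite_support[OF fin] atom(2)])
    have "v (m + l) * (cmod c * K) \<le> (v m * v l) * (cmod c * K)"
      using v(2) K by (intro mult_right_mono) auto
    also have "\<dots> = (cmod c * v m) * (v l * K)" by simp
    also have "\<dots> \<le> (cmod c * v m) * r"
      using atom(3) v(1) by (intro mult_left_mono) auto
    finally show "v (m + l) * (cmod c * K) \<le> cmod c * v m * r" .
  qed
next
  case (add r x s y t)
  have "gauge_le v B (cmod c * v m * t)
     (\<lambda>n. c * x (n - m) * phase m (n - m) + c * y (n - m) * phase m (n - m))"
    using add.IH
    by (rule gauge_le.add) (use add.hyps(3) v(1)[of m] in \<open>simp flip: distrib_left add: mult_left_mono\<close>)
  then show ?case by (simp add: distrib_left distrib_right)
next
  case (sum r x t)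
  have "gauge_le v B (cmod c * v m * t) (\<lambda>n. \<Sum>\<^sub>\<infinity>i. c * x i (n - m) * phase m (n - m))"
  proof (rule gauge_le.sum[where r = "\<lambda>i. cmod c * v m * r i"])
    show "(\<Sum>\<^sub>\<infinity>i. cmod c * v m * r i) \<le> cmod c * v m * t"
      using sum.hyps(3) v(1)[of m] by (simp add: infsum_cmult_right' mult_left_mono)
  qed (use sum in \<open>auto intro: summable_on_cmult_right\<close>)
  then show ?case by (simp add: infsum_cmult_right' infsum_cmult_left')
qed

text \<open>Multiplication by a general element costs its weighted norm but does not enlarge
  \<open>B\<close>. This is the estimate for the small remainder.\<close>

lemma gauge_le_twconv:
  assumes v: "\<And>x. 0 \<le> v x" "\<And>x y. v (x + y) \<le> v x * v y" and B: "finite B"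
    and s: "in_Av v s" and x: "gauge_le v B r x"
  shows "gauge_le v B (wnorm v s * r) (twconv s x)"
proof -
  have "gauge_le v B (wnorm v s * r) (\<lambda>n. \<Sum>\<^sub>\<infinity>l. s l * x (n - l) * phase l (n - l))"
  proof (rule gauge_le.sum[where r = "\<lambda>l. cmod (s l) * v l * r"])
    show "gauge_le v B (cmod (s l) * v l * r) (\<lambda>n. s l * x (n - l) * phase l (n - l))" for l
      by (rule gauge_le_translate[OF v B x])
    show "(\<lambda>l. cmod (s l) * v l * r) summable_on UNIV"
      using s unfolding in_Av_def by (intro summable_on_cmult_left) (simp add: mult.commute)
    show "(\<Sum>\<^sub>\<infinity>l. cmod (s l) * v l * r) \<le> wnorm v s * r"
      by (simp only: infsum_cmult_left' wnorm_def mult.commute[of "cmod _"] order_refl)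
  qed
  then show ?thesis by (simp add: twconv_def[abs_def])
qed

lemma twconv_finite:
  assumes "finite F" "{l. p l \<noteq> 0} \<subseteq> F"
  shows "twconv p x n = (\<Sum>l\<in>F. p l * x (n - l) * phase l (n - l))"
proof -
  have "twconv p x n = infsum (\<lambda>l. p l * x (n - l) * phase l (n - l)) F"
    unfolding twconv_def using assms(2) by (intro infsum_cong_neutral) auto
  then show ?thesis using assms(1) by simp
qed

lemma has_sum_finite_sum:
  fixes g :: "'l \<Rightarrow> 'i \<Rightarrow> complex"
  assumes "finite F" "\<And>l. l \<in> F \<Longrightarrow> (g l has_sum G l) A"
  shows "((\<lambda>i. \<Sum>l\<in>F. g l i) has_sum (\<Sum>l\<in>F. G l)) A"
  using assms by (induction F rule: finite_induct) (auto intro: has_sum_add)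

text \<open>Multiplication by a finitely supported element costs only its operator bound, at the
  price of enlarging \<open>B\<close> by \<open>F\<close>. The centre \<open>l\<close> of an atom
  stays in place because the index group is commutative.\<close>

lemma gauge_le_twconv_finite:
  assumes v: "\<And>x. 1 \<le> v x" "\<And>x y. v (x + y) \<le> v x * v y" and B: "finite B"
    and F: "finite F" "{l. p l \<noteq> 0} \<subseteq> F" and p: "opbound p K"
    and FB: "\<And>f b. f \<in> F \<Longrightarrow> b \<in> B \<Longrightarrow> f + b \<in> B'"
    and x: "gauge_le v B r x"
  shows "gauge_le v B' (K * r) (twconv p x)"
proof -
  note tw = twconv_finite[OF F]
  have K: "0 \<le> K" using p by (simp add: opbound_def)
  show ?thesis
    using x
  proof induction
    case (atom x l L r)
    have fin: "finite {n. x n \<noteq> 0}" using B atom(1) by (rule finite_translate_support)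
    show ?case
    proof (rule gauge_le.atom[of _ l _ "K * L"])
      show "{n. twconv p x n \<noteq> 0} \<subseteq> (+) l ` B'"
      proof
        fix n assume "n \<in> {n. twconv p x n \<noteq> 0}"
        then have "(\<Sum>k\<in>F. p k * x (n - k) * phase k (n - k)) \<noteq> 0" by (simp add: tw)
        then obtain k where k: "k \<in> F" "p k * x (n - k) * phase k (n - k) \<noteq> 0"
          by (meson sum.neutral)
        then have "n - k \<in> (+) l ` B" using atom(1) by auto
        then obtain b where "b \<in> B" "n - k = l + b" by auto
        then show "n \<in> (+) l ` B'"
          using FB[OF k(1)] by (intro image_eqI[of _ _ "k + b"]) (auto simp: algebra_simps)
      qed
      show "opbound (twconv p x) (K * L)"
        by (rule opbound_twconv[OF summable_on_finite_support[OF finite_subset[OF F(2,1)]] p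
              summable_on_finite_support[OF fin] atom(2)])
      show "v l * (K * L) \<le> K * r"
        using mult_left_mono[OF atom(3) K] by (simp add: mult_ac)
    qed
  next
    case (add r x s y t)
    have "gauge_le v B' (K * t) (\<lambda>n. twconv p x n + twconv p y n)"
      using add.IH
      by (rule gauge_le.add) (use add.hyps(3) K in \<open>simp flip: distrib_left add: mult_left_mono\<close>)
    moreover have "twconv p (\<lambda>n. x n + y n) = (\<lambda>n. twconv p x n + twconv p y n)"
      by (simp add: fun_eq_iff tw sum.distrib distrib_left distrib_right)
    ultimately show ?case by simp
  next
    case (sum r x t)
    \<comment> \<open>Any bound of \<open>v\<close> on \<open>B\<close> will do: it serves to make
      the family \<open>x i n\<close> summable in \<open>i\<close>, so that the finite sum over
      \<open>F\<close> can be exchanged with the series.\<close>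
    obtain W where W: "0 \<le> W" "\<And>b. b \<in> B \<Longrightarrow> v b \<le> W"
    proof (rule that[of "Max (insert 0 (v ` B))"])
      show "0 \<le> Max (insert 0 (v ` B))" using B by simp
      show "v b \<le> Max (insert 0 (v ` B))" if "b \<in> B" for b using B that by simp
    qed
    note bd = gauge_le_imp_wnorm_le[OF v B W(2,1) sum.hyps(1)]
    have s: "(\<lambda>i. real (card B) * W * r i) summable_on UNIV"
      by (rule summable_on_cmult_right[OF sum.hyps(2)])
    have xs: "(\<lambda>(i, n). x i n) summable_on UNIV"
      by (rule wnorm_infsum_le(3)[where v = v, OF v(1) _ _ s]) (use bd in blast)+
    have xs': "(\<lambda>i. x i n) summable_on UNIV" for n
    proof -
      have "(\<lambda>(n, i). x i n) summable_on (UNIV \<times> UNIV)"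
        using xs summable_on_swap[of "\<lambda>(i, n). x i n" UNIV UNIV] by simp
      from summable_on_SigmaD1[OF this, of n] show ?thesis by simp
    qed
    have "gauge_le v B' (K * t) (\<lambda>n. \<Sum>\<^sub>\<infinity>i. twconv p (x i) n)"
    proof (rule gauge_le.sum[where r = "\<lambda>i. K * r i"])
      show "(\<Sum>\<^sub>\<infinity>i. K * r i) \<le> K * t"
        using sum.hyps(3) K by (simp add: infsum_cmult_right' mult_left_mono)
    qed (use sum in \<open>auto intro: summable_on_cmult_right\<close>)
    moreover have "twconv p (\<lambda>n. \<Sum>\<^sub>\<infinity>i. x i n) n = (\<Sum>\<^sub>\<infinity>i. twconv p (x i) n)" for n
      unfolding tw
      by (rule infsumI[symmetric], rule has_sum_finite_sum[OF F(1)],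
          intro has_sum_cmult_left has_sum_cmult_right has_sum_infsum xs')
    ultimately show ?case by (simp add: fun_eq_iff)
  qed
qed

lemma twconv_summable:
  assumes "a summable_on UNIV" "b summable_on UNIV"
  shows "(\<lambda>l. a l * b (n - l) * phase l (n - l)) summable_on UNIV"
proof -
  have "(\<lambda>(l, m). a l * b m * phase l m) summable_on UNIV"
    by (rule summable_on_complex_bound[OF summable_on_product[OF summable_on_cmod[OF assms(1)] summable_on_cmod[OF assms(2)]]])
       (auto simp: norm_mult)
  from infsum_shear(2)[OF this] show ?thesis .
qed

section \<open>Powers and the finite sets that carry them\<close>

primrec twpow :: "((real^'d) \<times> (real^'d) \<Rightarrow> complex) \<Rightarrow> nat \<Rightarrow> (real^'d) \<times> (real^'d) \<Rightarrow> complex" where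
  "twpow e 0 = delta"
| "twpow e (Suc n) = twconv e (twpow e n)"

text \<open>Bounding each multiplicity by \<open>k\<close> separately gives a set containing all
  sums of at most \<open>k\<close> elements of \<open>F\<close>. Recording multiplicities instead of
  words keeps its size polynomial in \<open>k\<close>.\<close>

definition combos :: "'a::real_vector set \<Rightarrow> nat \<Rightarrow> 'a set" where
  "combos F k = (\<lambda>m. \<Sum>f\<in>F. real (m f) *\<^sub>R f) ` (PiE F (\<lambda>_. {..k}))"

lemma finite_combos: "finite F \<Longrightarrow> finite (combos F k)"
  unfolding combos_def by (intro finite_imageI finite_PiE) auto

lemma card_combos_le: "finite F \<Longrightarrow> card (combos F k) \<le> (k + 1) ^ card F"
proof -
  assume F: "finite F"
  have "card (combos F k) \<le> card (PiE F (\<lambda>_. {..k}))"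
    unfolding combos_def by (rule card_image_le) (use F in \<open>auto intro: finite_PiE\<close>)
  then show ?thesis using F by (simp add: card_PiE)
qed

lemma zero_in_combos: "0 \<in> combos F k"
  unfolding combos_def by (rule image_eqI[of _ _ "\<lambda>f\<in>F. 0"]) auto

lemma combos_Suc: "combos F k \<subseteq> combos F (Suc k)"
  unfolding combos_def by (intro image_mono PiE_mono) auto

lemma add_in_combos:
  assumes "finite F" "f \<in> F" "b \<in> combos F k"
  shows "f + b \<in> combos F (Suc k)"
proof -
  from assms(3) obtain m where m: "m \<in> PiE F (\<lambda>_. {..k})" "b = (\<Sum>g\<in>F. real (m g) *\<^sub>R g)"
    by (auto simp: combos_def)
  let ?m = "m(f := Suc (m f))"
  have "?m \<in> PiE F (\<lambda>_. {..Suc k})" using m(1) assms(2) by (fastforce simp: PiE_iff extensional_def)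
  moreover have "f + b = (\<Sum>g\<in>F. real (?m g) *\<^sub>R g)"
    unfolding m(2) using assms(1,2)
    by (simp add: sum.remove[of F f] scaleR_add_left algebra_simps)
  ultimately show ?thesis unfolding combos_def by blast
qed

lemma norm_combos_le:
  fixes F :: "'a::real_normed_vector set"
  assumes "b \<in> combos F k"
  shows "norm b \<le> real k * (\<Sum>f\<in>F. norm f)"
proof -
  from assms obtain m where m: "m \<in> PiE F (\<lambda>_. {..k})" "b = (\<Sum>g\<in>F. real (m g) *\<^sub>R g)"
    by (auto simp: combos_def)
  have "norm b \<le> (\<Sum>g\<in>F. norm (real (m g) *\<^sub>R g))" unfolding m(2) by (rule norm_sum)
  also have "\<dots> \<le> (\<Sum>g\<in>F. real k * norm g)"
    using m(1) by (intro sum_mono) (auto simp: PiE_iff intro!: mult_right_mono)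
  finally show ?thesis by (simp add: sum_distrib_left)
qed

text \<open>Each further factor \<open>p + s\<close> is split: \<open>p\<close> contributes its
  operator bound and enlarges the set by one step, \<open>s\<close> contributes its weighted norm
  and leaves the set alone.\<close>

lemma gauge_le_twpow:
  assumes v: "\<And>x. 1 \<le> v x" "\<And>x y. v (x + y) \<le> v x * v y" "v 0 = 1"
    and F: "finite F" "{l. p l \<noteq> 0} \<subseteq> F" and p: "opbound p K" and s: "in_Av v s"
  shows "gauge_le v (combos F n) ((K + wnorm v s) ^ n) (twpow (\<lambda>l. p l + s l) n)"
proof (induction n)
  case 0
  show ?case
    unfolding twpow.simps
  proof (rule gauge_le.atom[OF _ opbound_delta])
    show "{n. delta n \<noteq> 0} \<subseteq> (+) 0 ` combos F 0"
      using zero_in_combos[of F 0] by (simp add: delta_def)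
  qed (simp add: v(3))
next
  case (Suc n)
  have v0: "0 \<le> v x" for x using v(1)[of x] by linarith
  define x where "x = twpow (\<lambda>l. p l + s l) n"
  define r where "r = (K + wnorm v s) ^ n"
  have x: "gauge_le v (combos F n) r x" using Suc by (simp add: x_def r_def)
  note fin = finite_combos[OF F(1), of n]
  define W where "W = Max (insert 0 (v ` combos F n))"
  have W: "0 \<le> W" "\<And>b. b \<in> combos F n \<Longrightarrow> v b \<le> W" using fin by (auto simp: W_def)
  have xs: "x summable_on UNIV"
  proof (rule in_Av_summable[where v = v, OF v(1)])
    show "in_Av v x"
      using gauge_le_imp_wnorm_le[OF v(1,2) fin _ W(1) x] W(2) by blast
  qed
  have ss: "s summable_on UNIV" by (rule in_Av_summable[OF v(1) s])
  have ps: "p summable_on UNIV" by (rule summable_on_finite_support[OF finite_subset[OF F(2,1)]])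
  have "gauge_le v (combos F (Suc n)) ((K + wnorm v s) * r) (\<lambda>n. twconv p x n + twconv s x n)"
  proof (rule gauge_le.add)
    show "gauge_le v (combos F (Suc n)) (K * r) (twconv p x)"
      by (rule gauge_le_twconv_finite[OF v(1,2) fin F p add_in_combos[OF F(1)] x])
    show "gauge_le v (combos F (Suc n)) (wnorm v s * r) (twconv s x)"
      by (rule gauge_le_mono_set[OF gauge_le_twconv[OF v0 v(2) fin s x] combos_Suc])
  qed (simp add: distrib_right)
  moreover have "twconv (\<lambda>l. p l + s l) x = (\<lambda>n. twconv p x n + twconv s x n)"
    unfolding fun_eq_iff twconv_def using twconv_summable[OF ps xs] twconv_summable[OF ss xs]
    by (simp add: distrib_right infsum_add)
  ultimately show ?case by (simp add: x_def r_def)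
qed

section \<open>Growth of the weight and the spectral radius\<close>

lemma weight_ge_1:
  assumes "is_weight v"
  shows "1 \<le> v x"
proof -
  have "v (0 *\<^sub>R x) \<le> v (1 *\<^sub>R x)"
    using assms unfolding is_weight_def by (metis order_refl zero_le_one)
  then show ?thesis using assms by (simp add: is_weight_def)
qed

lemma weight_radial: "is_weight v \<Longrightarrow> 0 \<le> s \<Longrightarrow> s \<le> t \<Longrightarrow> v (s *\<^sub>R x) \<le> v (t *\<^sub>R x)"
  unfolding is_weight_def by blast

lemma weight_uminus: "is_weight v \<Longrightarrow> v (- x) = v x"
  unfolding is_weight_def by blast

text \<open>Provides boundedness of \<open>v\<close> on spheres, so that the supremum in
  \<open>wmax\<close> is a genuine one. The vector is expanded in the standard basis, and symmetry
  with radial monotonicity handles each axis.\<close>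

lemma weight_le_prod_Basis:
  fixes v :: "(real^'d) \<times> (real^'d) \<Rightarrow> real"
  assumes "admissible v" "norm x \<le> r"
  shows "v x \<le> (\<Prod>b\<in>Basis. v (r *\<^sub>R b))"
proof -
  have w: "is_weight v" and sub: "\<And>x y. v (x + y) \<le> v x * v y"
    using assms(1) by (auto simp: admissible_def)
  have v0: "0 \<le> v y" for y using weight_ge_1[OF w, of y] by linarith
  have r: "0 \<le> r" using assms(2) norm_ge_zero[of x] by linarith
  have "v (\<Sum>b\<in>S. (x \<bullet> b) *\<^sub>R b) \<le> (\<Prod>b\<in>S. v ((x \<bullet> b) *\<^sub>R b))" if "finite S" for S
    using that
  proof (induction S rule: finite_induct)
    case empty
    then show ?case using w by (simp add: is_weight_def)
  next
    case (insert b S)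
    then show ?case
      using sub[of "(x \<bullet> b) *\<^sub>R b" "\<Sum>b\<in>S. (x \<bullet> b) *\<^sub>R b"] mult_left_mono[OF insert.IH v0[of "(x \<bullet> b) *\<^sub>R b"]]
      by simp
  qed
  from this[OF finite_Basis] have "v x \<le> (\<Prod>b\<in>Basis. v ((x \<bullet> b) *\<^sub>R b))"
    by (simp add: euclidean_representation)
  also have "\<dots> \<le> (\<Prod>b\<in>Basis. v (r *\<^sub>R b))"
  proof (rule prod_mono, intro conjI v0)
    fix b :: "(real^'d) \<times> (real^'d)" assume b: "b \<in> Basis"
    have "\<bar>x \<bullet> b\<bar> \<le> r" using Basis_le_norm[OF b, of x] assms(2) by linarith
    then have "v (\<bar>x \<bullet> b\<bar> *\<^sub>R b) \<le> v (r *\<^sub>R b)"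
      by (intro weight_radial[OF w]) auto
    moreover have "v (\<bar>x \<bullet> b\<bar> *\<^sub>R b) = v ((x \<bullet> b) *\<^sub>R b)"
      using weight_uminus[OF w, of "(x \<bullet> b) *\<^sub>R b"] by (cases "0 \<le> x \<bullet> b") auto
    ultimately show "v ((x \<bullet> b) *\<^sub>R b) \<le> v (r *\<^sub>R b)" by simp
  qed
  finally show ?thesis .
qed

text \<open>Pushing \<open>b\<close> outwards along its ray to the sphere of radius \<open>r\<close>
  does not decrease \<open>v\<close>.\<close>

lemma weight_le_wmax:
  fixes v :: "(real^'d) \<times> (real^'d) \<Rightarrow> real"
  assumes v: "admissible v" and b: "norm b \<le> r"
  shows "v b \<le> wmax v r"
proof -
  have w: "is_weight v" using v by (simp add: admissible_def)
  have r: "0 \<le> r" using b norm_ge_zero[of b] by linarith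
  have bdd: "bdd_above (v ` {x. norm x = r})"
    by (rule bdd_aboveI2[where M = "\<Prod>b\<in>Basis. v (r *\<^sub>R b)"]) (auto intro: weight_le_prod_Basis[OF v])
  obtain y where y: "norm y = r" "v b \<le> v y"
  proof (cases "b = 0")
    \<comment> \<open>The origin determines no ray, but \<open>v 0 = 1\<close> is the least value,
      so any point of the sphere serves.\<close>
    case True
    obtain e :: "(real^'d) \<times> (real^'d)" where "e \<in> Basis" using nonempty_Basis by blast
    then have "norm (r *\<^sub>R e) = r" using r by simp
    moreover have "v b \<le> v (r *\<^sub>R e)"
      using weight_ge_1[OF w] w True by (simp add: is_weight_def)
    ultimately show ?thesis using that by blast
  next
    case False
    have "v (1 *\<^sub>R b) \<le> v ((r / norm b) *\<^sub>R b)"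
      using w b False unfolding is_weight_def by (metis le_divide_eq_1_pos zero_le_one zero_less_norm_iff)
    then show ?thesis using that[of "(r / norm b) *\<^sub>R b"] r False by simp
  qed
  then show ?thesis
    unfolding wmax_def using cSUP_upper[OF _ bdd, of y] by simp
qed

text \<open>By the root test: polynomial and subexponential factors have \<open>n\<close>-th roots
  tending to 1, which leaves \<open>t < 1\<close>.\<close>

lemma summable_subexponential_growth:
  fixes w :: "nat \<Rightarrow> real"
  assumes w: "\<And>n. 1 \<le> w n" "(\<lambda>n. w n powr (1 / real n)) \<longlonglongrightarrow> 1" and t: "0 \<le> t" "t < 1"
  shows "summable (\<lambda>n. real (n + 1) ^ k * w n * t ^ n)"
proof (rule summable_comparison_test')
  \<comment> \<open>For \<open>n \<ge> 1\<close> one has \<open>n + 1 \<le> 2 * n\<close>, and the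
    \<open>n\<close>-th roots of 2 and of \<open>n\<close> tend to 1.\<close>
  define f where "f n = (2 * real n) ^ k * w n * t ^ n" for n
  have w0: "0 \<le> w n" for n using w(1)[of n] by linarith
  have "(\<lambda>n. (root n 2 * root n n) ^ k * w n powr (1 / real n) * t) \<longlonglongrightarrow> (1 * 1) ^ k * 1 * t"
    by (intro tendsto_intros LIMSEQ_root LIMSEQ_root_const w(2)) simp
  moreover have "\<forall>\<^sub>F n in sequentially. (root n 2 * root n n) ^ k * w n powr (1 / real n) * t = root n (norm (f n))"
    using eventually_gt_at_top[of 0]
  proof eventually_elim
    case (elim n)
    have "norm (f n) = (2 * real n) ^ k * w n * t ^ n" using w0 t by (simp add: f_def abs_mult)
    then show ?case
      using elim w0[of n] t(1)
      by (simp add: real_root_mult real_root_power real_root_power_cancel root_powr_inverse[of n "w n"] power_mult_distrib)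
  qed
  ultimately have "(\<lambda>n. root n (norm (f n))) \<longlonglongrightarrow> t"
    by (simp add: tendsto_cong)
  then show "summable f" by (rule root_test_convergence[OF _ t(2)])
  fix n :: nat assume n: "1 \<le> n"
  have "real (n + 1) ^ k \<le> (2 * real n) ^ k" using n by (intro power_mono) auto
  then show "norm (real (n + 1) ^ k * w n * t ^ n) \<le> f n"
    using w0 t by (auto simp: f_def abs_mult intro!: mult_right_mono)
qed

text \<open>The heart of the argument: an operator bound below 1 on \<open>L2\<close> already forces
  convergence of the Neumann series in the weighted norm, even if \<open>wnorm v e\<close> is
  large.\<close>

lemma summable_wnorm_twpow:
  fixes v :: "(real^'d) \<times> (real^'d) \<Rightarrow> real"
  assumes v: "admissible v" and e: "in_Av v e" "opbound e q" and q: "q < 1"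
  shows "in_Av v (twpow e n)" "summable (\<lambda>n. wnorm v (twpow e n))"
proof -
  have w: "is_weight v" and sub: "\<And>x y. v (x + y) \<le> v x * v y"
    using v by (auto simp: admissible_def)
  have v1: "1 \<le> v y" for y by (rule weight_ge_1[OF w])
  have v0: "0 \<le> v y" for y using v1[of y] by linarith
  have vz: "v 0 = 1" using w by (simp add: is_weight_def)
  \<comment> \<open>The finite part \<open>p = e - s\<close> has operator bound
    \<open>q + d\<close>, and \<open>s\<close> adds at most another \<open>d\<close>. The rate is
    then \<open>t = q + 2 * d = (1 + q) / 2 < 1\<close>.\<close>
  define d where "d = (1 - q) / 4"
  have d: "0 < d" using q by (simp add: d_def)
  have es: "(\<lambda>l. v l * cmod (e l)) summable_on UNIV" using e(1) by (simp add: in_Av_def)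
  obtain F where F: "finite F" "dist (\<Sum>l\<in>F. v l * cmod (e l)) (wnorm v e) \<le> d"
    using infsum_finite_approximation[OF es d] unfolding wnorm_def by blast
  define p where "p l = (if l \<in> F then e l else 0)" for l
  define s where "s l = (if l \<in> F then 0 else e l)" for l
  have eps: "e = (\<lambda>l. p l + s l)" by (auto simp: p_def s_def)
  have pF: "{l. p l \<noteq> 0} \<subseteq> F" by (auto simp: p_def)
  have sA: "in_Av v s"
    unfolding in_Av_def by (rule summable_on_comparison_test[OF es]) (auto simp: s_def v0)
  have "wnorm v s = infsum (\<lambda>l. v l * cmod (e l)) (UNIV - F)"
    unfolding wnorm_def by (rule infsum_cong_neutral) (auto simp: s_def)
  also have "\<dots> = wnorm v e - (\<Sum>l\<in>F. v l * cmod (e l))"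
    unfolding wnorm_def using F(1) by (subst infsum_Diff[OF es]) auto
  finally have sn: "wnorm v s \<le> d" using F(2) by (simp add: dist_real_def)
  have ss: "s summable_on UNIV" by (rule in_Av_summable[where v = v, OF v1 sA])
  have "opbound s d"
    by (rule opbound_mono[OF opbound_l1[OF ss]])
       (use infsum_cmod_le_wnorm[where v = v, OF v1 sA] sn in linarith)
  then have "opbound (\<lambda>l. (- 1) * s l) d" using opbound_scale[OF ss, of d "- 1"] by simp
  then have "opbound (\<lambda>l. e l + (- 1) * s l) (q + d)"
    by (intro opbound_add summable_on_cmult_right ss e(2) in_Av_summable[where v = v, OF v1 e(1)])
  then have pb: "opbound p (q + d)" by (simp add: eps)
  define t where "t = q + 2 * d"
  have q0: "0 \<le> q" using e(2) by (simp add: opbound_def)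
  have t: "0 \<le> t" "t < 1" using q d q0 by (auto simp: t_def d_def field_simps)
  define R where "R = (\<Sum>f\<in>F. norm f)"
  have R: "0 \<le> R" by (simp add: R_def sum_nonneg)
  have w1: "1 \<le> wmax v (real n * R)" for n
    using weight_le_wmax[OF v, of 0 "real n * R"] R vz by simp
  have bd: "in_Av v (twpow e n) \<and>
      wnorm v (twpow e n) \<le> real (card (combos F n)) * wmax v (real n * R) * (q + d + wnorm v s) ^ n" for n
    using gauge_le_twpow[where v = v, OF v1 sub vz F(1) pF pb sA, of n] unfolding eps[symmetric]
  proof (rule gauge_le_imp_wnorm_le[where v = v, OF v1 sub finite_combos[OF F(1)], rotated 2])
    show "v b \<le> wmax v (real n * R)" if "b \<in> combos F n" for b
      by (rule weight_le_wmax[OF v]) (use norm_combos_le[OF that] in \<open>simp add: R_def\<close>)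
    show "0 \<le> wmax v (real n * R)" using w1[of n] by linarith
  qed
  then show "in_Av v (twpow e n)" by blast
  show "summable (\<lambda>n. wnorm v (twpow e n))"
  proof (rule summable_comparison_test')
    show "summable (\<lambda>n. real (n + 1) ^ card F * wmax v (real n * R) * t ^ n)"
      by (rule summable_subexponential_growth[OF w1 _ t]) (use v R in \<open>simp add: admissible_def\<close>)
    fix n :: nat assume "0 \<le> n"
    have "0 \<le> wnorm v s" by (simp add: wnorm_def v0 infsum_nonneg)
    then have "(q + d + wnorm v s) ^ n \<le> t ^ n"
      using sn q0 d by (intro power_mono) (auto simp: t_def)
    moreover have "real (card (combos F n)) \<le> real (n + 1) ^ card F"
      using card_combos_le[OF F(1), of n] by (metis of_nat_le_iff of_nat_power)
    ultimately have "real (card (combos F n)) * wmax v (real n * R) * (q + d + wnorm v s) ^ n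
       \<le> real (n + 1) ^ card F * wmax v (real n * R) * t ^ n"
      using w1[of n] \<open>0 \<le> wnorm v s\<close> q0 d by (intro mult_mono) auto
    moreover have "0 \<le> wnorm v (twpow e n)" by (simp add: wnorm_def v0 infsum_nonneg)
    ultimately show "norm (wnorm v (twpow e n)) \<le> real (n + 1) ^ card F * wmax v (real n * R) * t ^ n"
      using bd[of n] by simp
  qed
qed

subsection \<open>Adjoints and inversion\<close>

text \<open>Coefficients of the adjoint operator, since the adjoint of \<open>U_l\<close> is
  \<open>phase l l * U_(- l)\<close> and \<open>phase\<close> is unchanged when both arguments
  change sign.\<close>

definition adj :: "((real^'d) \<times> (real^'d) \<Rightarrow> complex) \<Rightarrow> (real^'d) \<times> (real^'d) \<Rightarrow> complex" where
  "adj a m = cnj (a (- m)) * phase m m"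

lemma in_Av_adj:
  assumes "is_weight v" "in_Av v a"
  shows "in_Av v (adj a)"
proof -
  have "(\<lambda>m. v m * cmod (adj a m)) summable_on UNIV \<longleftrightarrow> (\<lambda>l. v l * cmod (a l)) summable_on UNIV"
    by (rule summable_on_reindex_bij_witness[where i = uminus and j = uminus])
       (auto simp: adj_def norm_mult weight_uminus[OF assms(1)] simp flip: uminus_Pair)
  then show ?thesis using assms(2) by (simp add: in_Av_def)
qed

lemma infsum_cmod_adj: "(\<Sum>\<^sub>\<infinity>m. cmod (adj a m)) = (\<Sum>\<^sub>\<infinity>l. cmod (a l))"
  by (rule infsum_reindex_bij_witness[where i = uminus and j = uminus])
     (auto simp: adj_def norm_mult)

text \<open>The crude bound suffices: it is used to interchange sum and integral, where only
  uniformity over the shifts of \<open>f\<close> matters.\<close>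

lemma L2_product_integrable:
  assumes f: "f \<in> L2" and g: "g \<in> L2"
  shows "integrable lborel (\<lambda>x. f x * cnj (g x))"
    and "(\<integral>x. cmod (f x * cnj (g x)) \<partial>lborel) \<le> (L2norm f)\<^sup>2 + (L2norm g)\<^sup>2"
proof -
  note [measurable] = L2D(1)[OF f] L2D(1)[OF g]
  note int = L2D(2)[OF f] L2D(2)[OF g]
  have pt: "cmod (f x * cnj (g x)) \<le> (cmod (f x))\<^sup>2 + (cmod (g x))\<^sup>2" for x
  proof -
    have "2 * cmod (f x) * cmod (g x) \<le> (cmod (f x))\<^sup>2 + (cmod (g x))\<^sup>2"
      by (rule sum_squares_bound)
    moreover have "0 \<le> cmod (f x) * cmod (g x)" by simp
    ultimately have "cmod (f x) * cmod (g x) \<le> (cmod (f x))\<^sup>2 + (cmod (g x))\<^sup>2" by linarith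
    then show ?thesis by (simp add: norm_mult)
  qed
  have m: "(\<lambda>x. cnj (g x)) \<in> borel_measurable borel"
    by (rule borel_measurable_continuous_onI[THEN measurable_compose[rotated]]) (auto intro!: continuous_intros)
  show i: "integrable lborel (\<lambda>x. f x * cnj (g x))"
    by (rule Bochner_Integration.integrable_bound[OF Bochner_Integration.integrable_add[OF int]])
       (use m pt in auto)
  have "(\<integral>x. cmod (f x * cnj (g x)) \<partial>lborel) \<le> (\<integral>x. (cmod (f x))\<^sup>2 + (cmod (g x))\<^sup>2 \<partial>lborel)"
    using int pt by (intro integral_mono integrable_norm[OF i]) auto
  then show "(\<integral>x. cmod (f x * cnj (g x)) \<partial>lborel) \<le> (L2norm f)\<^sup>2 + (L2norm g)\<^sup>2"
    using int by (simp add: L2norm_square)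
qed

lemma inner_series_op:
  assumes a: "a summable_on UNIV" and f: "f \<in> L2" and g: "g \<in> L2"
  shows "(\<integral>x. series_op a f x * cnj (g x) \<partial>lborel) = (\<Sum>\<^sub>\<infinity>l. a l * (\<integral>x. tf_shift l f x * cnj (g x) \<partial>lborel))"
proof -
  define h where "h l x = a l * (tf_shift l f x * cnj (g x))" for l x
  note ti = L2_product_integrable[OF tf_shift_L2(1)[OF f] g]
  have supp: "countable {l. h l \<noteq> (\<lambda>_. 0)}"
    by (rule countable_subset[OF _ countable_support[OF a]]) (auto simp: h_def fun_eq_iff)
  have hi: "integrable lborel (h l)" for l
    unfolding h_def using ti(1) by (rule integrable_mult_right)
  have "(\<integral>x. cmod (h l x) \<partial>lborel) \<le> cmod (a l) * ((L2norm f)\<^sup>2 + (L2norm g)\<^sup>2)" for l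
    using mult_left_mono[OF ti(2)[of l], of "cmod (a l)"] tf_shift_L2(2)[OF f, of l]
    by (simp only: h_def norm_mult[of "a l"] integral_mult_right_zero norm_ge_zero)
  then have hs: "(\<lambda>l. \<integral>x. cmod (h l x) \<partial>lborel) summable_on UNIV"
    by (rule summable_on_comparison_test[OF summable_on_cmult_left[OF summable_on_cmod[OF a]]]) simp
  have "series_op a f x * cnj (g x) = (\<Sum>\<^sub>\<infinity>l. h l x)" for x
    by (simp add: series_op_def h_def infsum_cmult_left' flip: mult.assoc)
  then have "(\<integral>x. series_op a f x * cnj (g x) \<partial>lborel) = (\<Sum>\<^sub>\<infinity>l. \<integral>x. h l x \<partial>lborel)"
    using infsum_integral_interchange(3)[where h = h, OF sigma_finite_lborel supp hi hs] by simp
  then show ?thesis by (simp add: h_def)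
qed

text \<open>Translating the variable of integration by \<open>fst l\<close> moves the shift to the
  other factor; the phase comes from the modulation.\<close>

lemma inner_tf_shift:
  assumes f: "f \<in> L2" and g: "g \<in> L2"
  shows "(\<integral>x. tf_shift l f x * cnj (g x) \<partial>lborel)
     = cnj (phase l l * (\<integral>x. tf_shift (- l) g x * cnj (f x) \<partial>lborel))"
proof -
  note [measurable] = L2D(1)[OF f] L2D(1)[OF g]
  define F where "F y = cnj (phase l l) * (f y * cnj (tf_shift (- l) g y))" for y
  have m: "(\<lambda>x. cnj (h x)) \<in> borel_measurable borel" if "h \<in> borel_measurable borel" for h :: "real^'a \<Rightarrow> complex"
    by (rule measurable_compose[OF that borel_measurable_continuous_onI]) (auto intro!: continuous_intros)
  have Fm: "F \<in> borel_measurable borel"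
    unfolding F_def using m[OF measurable_tf_shift[OF L2D(1)[OF g], of "- l"]] by measurable
  have "tf_shift l f x * cnj (g x) = F (x - fst l)" for x
  proof -
    have "exp (\<i> * complex_of_real (snd l \<bullet> x))
        = exp (\<i> * complex_of_real (snd l \<bullet> fst l)) * exp (\<i> * complex_of_real (snd l \<bullet> (x - fst l)))"
      unfolding exp_add[symmetric] distrib_left[symmetric] of_real_add[symmetric]
      by (simp add: inner_diff_right)
    then show ?thesis
      by (simp add: F_def tf_shift_def phase_def exp_cnj)
  qed
  then have "(\<integral>x. tf_shift l f x * cnj (g x) \<partial>lborel) = (\<integral>x. F x \<partial>lborel)"
    using lborel_translate(2)[OF Fm, of "fst l"] by simp
  also have "\<dots> = (\<integral>x. cnj (phase l l * (tf_shift (- l) g x * cnj (f x))) \<partial>lborel)"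
    by (rule Bochner_Integration.integral_cong) (simp_all add: F_def)
  also have "\<dots> = cnj (\<integral>x. phase l l * (tf_shift (- l) g x * cnj (f x)) \<partial>lborel)"
    by (rule Bochner_Integration.integral_cnj)
  finally show ?thesis by simp
qed

lemma inner_series_op_adj:
  assumes a: "a summable_on UNIV" "adj a summable_on UNIV" and f: "f \<in> L2" and g: "g \<in> L2"
  shows "(\<integral>x. series_op a f x * cnj (g x) \<partial>lborel) = cnj (\<integral>x. series_op (adj a) g x * cnj (f x) \<partial>lborel)"
proof -
  have "cnj (\<integral>x. series_op (adj a) g x * cnj (f x) \<partial>lborel)
      = (\<Sum>\<^sub>\<infinity>m. cnj (adj a m * (\<integral>x. tf_shift m g x * cnj (f x) \<partial>lborel)))"
    unfolding inner_series_op[OF a(2) g f] by (rule infsum_cnj[symmetric])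
  also have "\<dots> = (\<Sum>\<^sub>\<infinity>l. a l * (\<integral>x. tf_shift l f x * cnj (g x) \<partial>lborel))"
  proof (rule infsum_reindex_bij_witness[where i = uminus and j = uminus])
    fix m :: "(real^'a) \<times> (real^'a)"
    show "a (- m) * (\<integral>x. tf_shift (- m) f x * cnj (g x) \<partial>lborel)
        = cnj (adj a m * (\<integral>x. tf_shift m g x * cnj (f x) \<partial>lborel))"
      unfolding inner_tf_shift[OF f g] by (simp add: adj_def phase_def)
  qed auto
  also have "\<dots> = (\<integral>x. series_op a f x * cnj (g x) \<partial>lborel)"
    by (rule inner_series_op[OF a(1) f g, symmetric])
  finally show ?thesis ..
qed

lemma L2norm_diff_square:
  assumes f: "f \<in> L2" and g: "g \<in> L2"
  shows "(L2norm (\<lambda>x. f x - g x))\<^sup>2 = (L2norm f)\<^sup>2 - 2 * Re (\<integral>x. g x * cnj (f x) \<partial>lborel) + (L2norm g)\<^sup>2"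
proof -
  note i = L2_product_integrable(1)[OF g f]
  define r where "r x = Re (g x * cnj (f x))" for x
  have r: "integrable lborel r" "(\<integral>x. r x \<partial>lborel) = Re (\<integral>x. g x * cnj (f x) \<partial>lborel)"
    unfolding r_def using integrable_Re[OF i] integral_Re[OF i] by auto
  have "(cmod (f x - g x))\<^sup>2 = (cmod (f x))\<^sup>2 - 2 * r x + (cmod (g x))\<^sup>2" for x
    unfolding cmod_power2 r_def by (simp add: power2_eq_square algebra_simps)
  then show ?thesis
    unfolding L2norm_square using L2D(2)[OF f] L2D(2)[OF g] r by simp
qed

lemma L2norm_square_complex:
  "complex_of_real ((L2norm g)\<^sup>2) = (\<integral>x. g x * cnj (g x) \<partial>lborel)"
proof -
  have "complex_of_real ((L2norm g)\<^sup>2) = (\<integral>x. complex_of_real ((cmod (g x))\<^sup>2) \<partial>lborel)"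
    unfolding L2norm_square by (rule integral_complex_of_real[symmetric])
  then show ?thesis by (simp only: complex_norm_square)
qed

text \<open>For \<open>M \<ge> \<parallel>T\<parallel>\<^sup>2\<close> one has
  \<open>\<parallel>f - T\<^sup>*Tf/M\<parallel>\<^sup>2 \<le> \<parallel>f\<parallel>\<^sup>2 - \<parallel>Tf\<parallel>\<^sup>2/M\<close>.\<close>

lemma opbound_one_minus_adj:
  fixes a :: "(real^'d) \<times> (real^'d) \<Rightarrow> complex"
  assumes a: "a summable_on UNIV" "adj a summable_on UNIV"
    and C: "0 < C" "\<And>f. f \<in> L2 \<Longrightarrow> L2norm f \<le> C * L2norm (series_op a f)"
    and M: "M = (\<Sum>\<^sub>\<infinity>l. cmod (a l))\<^sup>2 + 1"
  shows "\<exists>q<1. opbound (\<lambda>n. delta n - twconv (\<lambda>m. complex_of_real (1 / M) * adj a m) a n) q"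
proof -
  define A where "A = (\<Sum>\<^sub>\<infinity>l. cmod (a l))"
  define b where "b m = complex_of_real (1 / M) * adj a m" for m
  define e where "e n = delta n - twconv b a n" for n
  \<comment> \<open>The estimate below has the factor \<open>1 - 1 / (C\<^sup>2 * M)\<close> on
    squared norms; \<open>max 0\<close> ensures a nonnegative number under the root.\<close>
  define q where "q = sqrt (max 0 (1 - 1 / (C\<^sup>2 * M)))"
  have M0: "0 < M" unfolding M by (simp add: add_nonneg_pos)
  have q1: "q < 1"
    using C(1) M0 by (simp add: q_def)
  have bs: "b summable_on UNIV" unfolding b_def by (rule summable_on_cmult_right[OF a(2)])
  have ds: "(delta :: (real^'d) \<times> (real^'d) \<Rightarrow> complex) summable_on UNIV"
    by (rule summable_on_finite_support) (simp add: delta_def)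
  have es: "e summable_on UNIV"
    unfolding e_def using summable_on_add[OF ds summable_on_uminus[THEN iffD2, OF summable_on_twconv[OF bs a(1)]]]
    by simp
  have "L2norm (series_op e f) \<le> q * L2norm f" if f: "f \<in> L2" for f
  proof -
    define g where "g = series_op a f"
    define h where "h = series_op (adj a) g"
    have g: "g \<in> L2" unfolding g_def by (rule series_op_L2(1)[OF a(1) f])
    have h: "h \<in> L2" unfolding h_def by (rule series_op_L2(1)[OF a(2) g])
    have hn: "L2norm h \<le> A * L2norm g"
      unfolding h_def A_def using series_op_L2(2)[OF a(2) g] by (simp add: infsum_cmod_adj)
    define k where "k x = complex_of_real (1 / M) * h x" for x
    have k: "k \<in> L2" "L2norm k = L2norm h / M"
      unfolding k_def using L2_scale[OF h, of "complex_of_real (1 / M)"] M0 by (auto simp: norm_divide)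
    have fk: "(\<lambda>x. f x - k x) \<in> L2" by (rule L2_diff(1)[OF f k(1)])
    have "AE x in lborel. f x - k x = series_op e f x"
      using series_op_diff[OF ds summable_on_twconv[OF bs a(1)] f] series_op_twconv[OF bs a(1) f]
    proof eventually_elim
      case (elim x)
      then show ?case
        unfolding e_def[abs_def] using series_op_scale[of "complex_of_real (1 / M)" "adj a" g x]
        by (simp add: series_op_delta b_def[abs_def] k_def h_def g_def)
    qed
    then have "L2norm (series_op e f) = L2norm (\<lambda>x. f x - k x)"
      by (rule L2_AE_cong(2)[OF fk L2D(1)[OF series_op_L2(1)[OF es f]]])
    then have "(L2norm (series_op e f))\<^sup>2
        = (L2norm f)\<^sup>2 - 2 * Re (\<integral>x. k x * cnj (f x) \<partial>lborel) + (L2norm h / M)\<^sup>2"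
      using L2norm_diff_square[OF f k(1)] k(2) by simp
    \<comment> \<open>This is the inner product of \<open>T\<^sup>*Tf/M\<close> with
      \<open>f\<close>, equal to the squared norm of \<open>Tf\<close> over
      \<open>M\<close>.\<close>
    also have "(\<integral>x. k x * cnj (f x) \<partial>lborel) = complex_of_real ((L2norm g)\<^sup>2 / M)"
    proof -
      have "(\<integral>x. h x * cnj (f x) \<partial>lborel) = cnj (\<integral>x. g x * cnj (g x) \<partial>lborel)"
        unfolding h_def using inner_series_op_adj[OF a f g] by (simp add: g_def)
      also have "\<dots> = complex_of_real ((L2norm g)\<^sup>2)"
        unfolding L2norm_square_complex[symmetric] by (rule complex_cnj_complex_of_real)
      finally have "(\<integral>x. h x * cnj (f x) \<partial>lborel) = complex_of_real ((L2norm g)\<^sup>2)" .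
      then show ?thesis by (simp add: k_def mult.assoc)
    qed
    \<comment> \<open>By the choice of \<open>M\<close>, the quadratic term absorbs at most half of
      the cross term.\<close>
    also have "(L2norm h / M)\<^sup>2 \<le> (L2norm g)\<^sup>2 / M"
    proof -
      have "(L2norm h)\<^sup>2 \<le> (A * L2norm g)\<^sup>2"
        using hn by (intro power_mono) auto
      also have "\<dots> \<le> M * (L2norm g)\<^sup>2"
        unfolding power_mult_distrib by (intro mult_right_mono) (auto simp: M A_def)
      finally show ?thesis
        using M0 by (simp add: power_divide field_simps power2_eq_square)
    qed
    also have "(L2norm f)\<^sup>2 - 2 * Re (complex_of_real ((L2norm g)\<^sup>2 / M)) + (L2norm g)\<^sup>2 / M
        = (L2norm f)\<^sup>2 - (L2norm g)\<^sup>2 / M" by simp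
    \<comment> \<open>Boundedness below of \<open>T\<close> turns the gain in terms of
      \<open>g = Tf\<close> into one in terms of \<open>f\<close>.\<close>
    also have "\<dots> \<le> (L2norm f)\<^sup>2 - (L2norm f)\<^sup>2 / (C\<^sup>2 * M)"
    proof -
      have "(L2norm f)\<^sup>2 \<le> (C * L2norm g)\<^sup>2"
        using C(2)[OF f] by (intro power_mono) (auto simp: g_def)
      then have "(L2norm f)\<^sup>2 / C\<^sup>2 \<le> (L2norm g)\<^sup>2"
        using C(1) by (simp add: field_simps power_mult_distrib)
      then have "(L2norm f)\<^sup>2 / C\<^sup>2 / M \<le> (L2norm g)\<^sup>2 / M"
        using M0 by (intro divide_right_mono) auto
      then show ?thesis by (simp add: divide_divide_eq_left)
    qed
    also have "\<dots> = (1 - 1 / (C\<^sup>2 * M)) * (L2norm f)\<^sup>2" by (simp add: algebra_simps)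
    also have "\<dots> \<le> (q * L2norm f)\<^sup>2"
      unfolding q_def power_mult_distrib by (intro mult_right_mono) auto
    finally show ?thesis
      by (rule power2_le_imp_le) (auto simp: q_def intro!: mult_nonneg_nonneg)
  qed
  then have "opbound e q" by (simp add: opbound_def q_def)
  then show ?thesis using q1 unfolding e_def b_def by blast
qed

section \<open>Neumann series and the inverse\<close>

lemma series_op_twpow_commute:
  assumes e: "e summable_on UNIV" "\<And>n. twpow e n summable_on UNIV" and f: "f \<in> L2"
  shows "AE x in lborel. series_op (twpow e n) (series_op e f) x = series_op (twpow e (Suc n)) f x"
proof (induction n)
  case 0
  show ?case
    using series_op_twconv[OF e(1) e(2)[of 0] f] by (simp add: series_op_delta)
next
  case (Suc n)
  note ef = series_op_L2(1)[OF e(1) f]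
  have 1: "AE x in lborel. series_op e (series_op (twpow e n) (series_op e f)) x
      = series_op (twpow e (Suc n)) (series_op e f) x"
    \<comment> \<open>Powers are built by multiplying on the left, so the factor standing on the
      right is passed through the outer \<open>e\<close> with the induction hypothesis.\<close>
    using series_op_twconv[OF e(1) e(2)[of n] ef] by simp
  have 2: "AE x in lborel. series_op e (series_op (twpow e (Suc n)) f) x = series_op (twpow e (Suc (Suc n))) f x"
    using series_op_twconv[OF e(1) e(2)[of "Suc n"] f] by simp
  have 3: "AE x in lborel. series_op e (series_op (twpow e n) (series_op e f)) x
      = series_op e (series_op (twpow e (Suc n)) f) x"
    by (rule series_op_AE_cong[OF e(1) L2D(1)[OF series_op_L2(1)[OF e(2) ef]]
          L2D(1)[OF series_op_L2(1)[OF e(2) f]] Suc])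
  from 1 2 3 show ?case by eventually_elim simp
qed

text \<open>The almost everywhere summability of translates, applied to the index
  \<open>(n, l)\<close>, allows the two summations to be swapped pointwise.\<close>

lemma series_op_infsum_coeffs:
  fixes x :: "nat \<Rightarrow> (real^'d) \<times> (real^'d) \<Rightarrow> complex"
  assumes x: "(\<lambda>(n, l). x n l) summable_on UNIV" and f: "f \<in> L2"
  shows "AE y in lborel. (\<lambda>n. series_op (x n) f y) summable_on UNIV \<and>
     series_op (\<lambda>l. \<Sum>\<^sub>\<infinity>n. x n l) f y = (\<Sum>\<^sub>\<infinity>n. series_op (x n) f y)"
  using AE_abs_summable_translates[OF x f, of "\<lambda>(n, l). fst l"]
proof eventually_elim
  case (elim y)
  have s: "(\<lambda>(n, l). x n l * tf_shift l f y) summable_on (UNIV \<times> UNIV)"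
    unfolding UNIV_Times_UNIV
    by (rule summable_on_complex_bound[OF elim]) (auto simp: norm_mult cmod_tf_shift)
  have "(\<lambda>n. series_op (x n) f y) summable_on UNIV"
    unfolding series_op_def using summable_on_Sigma_banach[OF s] .
  moreover have "series_op (\<lambda>l. \<Sum>\<^sub>\<infinity>n. x n l) f y = (\<Sum>\<^sub>\<infinity>n. series_op (x n) f y)"
    unfolding series_op_def using infsum_swap_banach[OF s] by (simp add: infsum_cmult_left')
  ultimately show ?case ..
qed

lemma series_op_diff_arg:
  assumes a: "a summable_on UNIV" and f: "f \<in> L2" and g: "g \<in> L2"
  shows "AE x in lborel. series_op a (\<lambda>y. f y - g y) x = series_op a f x - series_op a g x"
  using AE_series_op_summable[OF a f] AE_series_op_summable[OF a g]
proof eventually_elim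
  case (elim x)
  have "a l * tf_shift l (\<lambda>y. f y - g y) x = a l * tf_shift l f x + - (a l * tf_shift l g x)" for l
    by (simp add: tf_shift_def algebra_simps)
  then show ?case
    using infsum_add[OF elim(1) summable_on_uminus[THEN iffD2, OF elim(2)]]
    by (simp add: series_op_def infsum_uminus)
qed

text \<open>The identity is proved pointwise almost everywhere: the terms
  \<open>E\<^sup>n(f - Ef)\<close> telescope. The function \<open>h\<close> stands for
  \<open>f - Ef\<close> up to a null set.\<close>

lemma series_op_Neumann:
  assumes e: "e summable_on UNIV" and x: "(\<lambda>(n, l). twpow e n l) summable_on UNIV"
    and f: "f \<in> L2" and h: "h \<in> L2" "AE x in lborel. h x = f x - series_op e f x"
  shows "AE x in lborel. series_op (\<lambda>l. \<Sum>\<^sub>\<infinity>n. twpow e n l) h x = f x"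
proof -
  have es: "twpow e n summable_on UNIV" for n
    using summable_on_SigmaD1[of "twpow e" UNIV "\<lambda>_. UNIV" n] x by simp
  note ef = series_op_L2(1)[OF e f]
  have "AE x in lborel. series_op (twpow e n) h x
      = series_op (twpow e n) f x - series_op (twpow e (Suc n)) f x" for n
  proof -
    have "AE x in lborel. series_op (twpow e n) h x = series_op (twpow e n) (\<lambda>x. f x - series_op e f x) x"
      by (rule series_op_AE_cong[OF es L2D(1)[OF h(1)] L2D(1)[OF L2_diff(1)[OF f ef]] h(2)])
    with series_op_diff_arg[OF es f ef, of n] series_op_twpow_commute[OF e es f, of n]
    show ?thesis by eventually_elim simp
  qed
  then have "AE x in lborel. \<forall>n. series_op (twpow e n) h x
      = series_op (twpow e n) f x - series_op (twpow e (Suc n)) f x"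
    by (subst AE_all_countable) blast
  with series_op_infsum_coeffs[OF x h(1)] series_op_infsum_coeffs[OF x f] show ?thesis
  proof eventually_elim
    case (elim x)
    define u where "u n = series_op (twpow e n) f x" for n
    have "summable u"
      using elim(2) unfolding u_def by (blast intro: summable_on_imp_summable)
    \<comment> \<open>The end term of the telescope vanishes in the limit because the powers applied
      to \<open>f\<close> are themselves summable at the point.\<close>
    then have "u \<longlonglongrightarrow> 0" by (rule summable_LIMSEQ_zero)
    then have "(\<lambda>n. u n - u (Suc n)) sums (u 0 - 0)" by (rule telescope_sums')
    then have "(\<lambda>n. series_op (twpow e n) h x) sums f x"
      using elim(3) by (simp add: u_def series_op_delta)
    moreover have "(\<lambda>n. series_op (twpow e n) h x) sums (\<Sum>\<^sub>\<infinity>n. series_op (twpow e n) h x)"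
      using elim(1) by (intro has_sum_imp_sums has_sum_infsum) blast
    ultimately show ?case using elim(1) sums_unique2 by metis
  qed
qed

theorem theorem2:
  fixes v :: "(real^'d) \<times> (real^'d) \<Rightarrow> real"
    and c :: "(real^'d) \<times> (real^'d) \<Rightarrow> complex"
  assumes "admissible v"
    and "in_Av v c"
    and "invertible_B_L2 (series_op c)"
  shows "\<exists>d. in_Av v d \<and>
           (\<forall>f\<in>L2. AE x in lborel. series_op d (series_op c f) x = f x) \<and>
           (\<forall>f\<in>L2. AE x in lborel. series_op c (series_op d f) x = f x)"
proof -
  have w: "is_weight v" and sub: "\<And>x y. v (x + y) \<le> v x * v y"
    using assms(1) by (auto simp: admissible_def)
  have v1: "1 \<le> v y" for y by (rule weight_ge_1[OF w])
  have v0: "0 \<le> v y" for y using v1[of y] by linarith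
  note Av_summable = in_Av_summable[where v = v, OF v1]
  note cs = Av_summable[OF assms(2)]
  obtain S where S: "bounded_op_L2 S" "\<And>f. f \<in> L2 \<Longrightarrow> AE x in lborel. S (series_op c f) x = f x"
      "\<And>f. f \<in> L2 \<Longrightarrow> AE x in lborel. series_op c (S f) x = f x"
    using assms(3) unfolding invertible_B_L2_def by blast
  have SL2: "S f \<in> L2" if "f \<in> L2" for f using S(1) that by (simp add: bounded_op_L2_def)
  obtain C0 where C0: "\<And>f. f \<in> L2 \<Longrightarrow> L2norm (S f) \<le> C0 * L2norm f"
    using S(1) unfolding bounded_op_L2_def by blast
  \<comment> \<open>The bounded inverse makes the operator bounded below. Replacing
    \<open>C0\<close> by \<open>\<bar>C0\<bar> + 1\<close> makes the constant positive.\<close>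
  have lower: "L2norm f \<le> (\<bar>C0\<bar> + 1) * L2norm (series_op c f)" if f: "f \<in> L2" for f
  proof -
    note cf = series_op_L2(1)[OF cs f]
    have "L2norm f = L2norm (S (series_op c f))"
      by (rule L2_AE_cong(2)[OF SL2[OF cf] L2D(1)[OF f] S(2)[OF f]])
    also have "\<dots> \<le> C0 * L2norm (series_op c f)" by (rule C0[OF cf])
    also have "\<dots> \<le> (\<bar>C0\<bar> + 1) * L2norm (series_op c f)"
      by (intro mult_right_mono) auto
    finally show ?thesis .
  qed
  define M where "M = (\<Sum>\<^sub>\<infinity>l. cmod (c l))\<^sup>2 + 1"
  \<comment> \<open>\<open>b\<close> represents \<open>T\<^sup>*/M\<close>, and \<open>e\<close>
    represents \<open>1 - T\<^sup>*T/M\<close>.\<close>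
  define b where "b m = complex_of_real (1 / M) * adj c m" for m
  define e where "e n = delta n - twconv b c n" for n
  have adjA: "in_Av v (adj c)" by (rule in_Av_adj[OF w assms(2)])
  have bA: "in_Av v b"
  proof -
    have "(\<lambda>l. cmod (complex_of_real (1 / M)) * (v l * cmod (adj c l))) summable_on UNIV"
      using adjA unfolding in_Av_def by (rule summable_on_cmult_right)
    then show ?thesis by (simp only: in_Av_def b_def norm_mult mult.left_commute)
  qed
  note bs = Av_summable[OF bA]
  have tA: "in_Av v (twconv b c)" by (rule in_Av_twconv[OF v0 sub bA assms(2)])
  have dA: "in_Av v delta"
    unfolding in_Av_def by (rule finite_nonzero_values_imp_summable_on) (simp add: delta_def)
  have eA: "in_Av v e"
  proof -
    have s: "(\<lambda>n. v n * cmod (delta n) + v n * cmod (twconv b c n)) summable_on UNIV"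
      using dA tA unfolding in_Av_def by (rule summable_on_add)
    have "v n * cmod (e n) \<le> v n * cmod (delta n) + v n * cmod (twconv b c n)" for n
      unfolding e_def distrib_left[symmetric] by (intro mult_left_mono norm_triangle_ineq4 v0)
    then show ?thesis
      unfolding in_Av_def by (rule summable_on_comparison_test[OF s]) (simp add: v0)
  qed
  obtain q where q: "q < 1" "opbound e q"
    using opbound_one_minus_adj[OF cs Av_summable[OF adjA] _ lower M_def] unfolding e_def b_def
    by (auto simp: add_nonneg_pos)
  note es = Av_summable[OF eA]
  note pA = summable_wnorm_twpow[OF assms(1) eA q(2,1)]
  \<comment> \<open>The Neumann sum, which inverts \<open>T\<^sup>*T/M\<close> from the left;
    composed with \<open>b\<close> it yields a left inverse of \<open>T\<close>.\<close>
  define g where "g l = (\<Sum>\<^sub>\<infinity>n. twpow e n l)" for l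
  have ws: "(\<lambda>n. wnorm v (twpow e n)) summable_on UNIV"
    using pA(2) by (rule summable_nonneg_imp_summable_on) (simp add: wnorm_def infsum_nonneg v0)
  have gA: "in_Av v g"
    unfolding g_def by (rule wnorm_infsum_le(1)[where v = v, OF v1 pA(1) order_refl ws])
  have ps: "(\<lambda>(n, l). twpow e n l) summable_on UNIV"
    by (rule wnorm_infsum_le(3)[where v = v, OF v1 pA(1) order_refl ws])
  define d where "d = twconv g b"
  have dAv: "in_Av v d" unfolding d_def by (rule in_Av_twconv[OF v0 sub gA bA])
  note d's = Av_summable[OF dAv]
  have left: "AE x in lborel. series_op d (series_op c f) x = f x" if f: "f \<in> L2" for f
  proof -
    note cf = series_op_L2(1)[OF cs f]
    note bcf = series_op_L2(1)[OF bs cf]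
    have "AE x in lborel. series_op b (series_op c f) x = f x - series_op e f x"
      using series_op_diff[OF Av_summable[OF dA] Av_summable[OF tA] f] series_op_twconv[OF bs cs f]
      by eventually_elim (simp add: e_def[abs_def] series_op_delta)
    from series_op_Neumann[OF es ps f bcf this]
    have "AE x in lborel. series_op g (series_op b (series_op c f)) x = f x"
      by (simp add: g_def[abs_def])
    with series_op_twconv[OF Av_summable[OF gA] bs cf] show ?thesis
      unfolding d_def by eventually_elim simp
  qed
  \<comment> \<open>Applying the left inverse \<open>d\<close> to \<open>T(Sf) = f\<close> shows
    that \<open>d\<close> represents the given two-sided inverse \<open>S\<close>, so it is a right
    inverse as well.\<close>
  have "AE x in lborel. series_op c (series_op d f) x = f x" if f: "f \<in> L2" for f
  proof -
    note Sf = SL2[OF f]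
    have "AE x in lborel. series_op d (series_op c (S f)) x = series_op d f x"
      by (rule series_op_AE_cong[OF d's L2D(1)[OF series_op_L2(1)[OF cs Sf]] L2D(1)[OF f] S(3)[OF f]])
    with left[OF Sf] have "AE x in lborel. series_op d f x = S f x"
      by eventually_elim simp
    then have "AE x in lborel. series_op c (series_op d f) x = series_op c (S f) x"
      by (rule series_op_AE_cong[OF cs L2D(1)[OF series_op_L2(1)[OF d's f]] L2D(1)[OF Sf]])
    with S(3)[OF f] show ?thesis by eventually_elim simp
  qed
  with dAv left show ?thesis by blast
qed

end
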